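(* Let $\tau$ and $\rho$ be primitive aperiodic substitutions with balanced growth and with $\lambda = Z(\tau) = Z(\rho) > 1$, and let $\rho^{-1} : X_\rho \to X_\rho$ be a fixed almost inverse of $\rho$ with balanced growth. Then there exist $D = D_{\tau,\rho} \in \mathbb{N}$ and $I = I_{\tau,\rho} \in \mathbb{N}$ with the following properties. For any block map $f : X_\tau \to X_\rho$, denoting $\Phi_i = \rho^{-i} \circ f \circ \tau^i$ where $\rho^{-i} = (\rho^{-1})^i$, we have $Z(\Phi_i) = 1$ and $D(\Phi_i) \leq D$ for all $i \in \mathbb{N}$, and $I(\Phi_i) \leq I$ for all large enough $i \in \mathbb{N}$ (in particular $Z(\Phi_i)$ and $D(\Phi_i)$ are well-defined).
   Context: $\mathbb{N}$ contains $0$. For a finite alphabet $A$, $A^*$ is the set of finite words, and $v \sqsubset w$ means that $v$ is a factor of $w$. The shift on $A^{\mathbb{N}}$ is $\sigma(x)_i = x_{i+1}$; a subshift is a closed $X \subset A^{\mathbb{N}}$ with $\sigma(X) \subset X$. A block map is a continuous map between subshifts commuting with $\sigma$. Substitutions. A substitution on $A$ is a map $\tau : A^* \to A^*$ with $\tau(uv) = \tau(u)\tau(v)$. Its one-sided subshift $X_\tau \subset A^{\mathbb{N}}$ is the set of $x \in A^{\mathbb{N}}$ all of whose factors are factors of $\tau^n(a)$ for some $a \in A$, $n \in \mathbb{N}$; $\tau$ acts on it by $\tau(x) = \tau(x_0)\tau(x_1)\cdots$. $\tau$ is primitive if for all $a,b \in A$, $a \sqsubset \tau^n(b)$ for all large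 enough $n$, and aperiodic if $X_\tau$ contains no $\sigma$-periodic point. Dill maps. A dill map between subshifts is a continuous map $\Phi : X \to Y$ for which there is a continuous $s : X \to \mathbb{N}$ with $\Phi(\sigma(x)) = \sigma^{s(x)}(\Phi(x))$ for all $x \in X$, and such that for all $x \in X$ there is $n \in \mathbb{N}$ with $s(\sigma^n(x)) > 0$. Block maps ($s = 1$) and the actions $\tau : X_\tau \to X_\tau$, $\tau(x) = \tau(x_0)\tau(x_1)\cdots$, of primitive aperiodic substitutions $\tau$ ($s(x) = |\tau(x_0)|$) are dill maps, and dill maps are closed under composition. An implementation of $\Phi$ is a continuous map $\phi$ from $X$ to the (discrete) set of finite words over the alphabet of $Y$ with $\Phi(x) = \phi(x)\phi(\sigma(x))\phi(\sigma^2(x))\cdots$ for all $x \in X$; when $Y$ contains no $\sigma$-periodic points it exists and is unique. Write ${}^n\phi(x) = \phi(x)\phi(\sigma(x))\cdots\phi(\sigma^{n-1}(x))$. Invariants. For a dill map $\Phi : X \to Y$, with $Y$ containing no $\sigma$-periodic points, and with implementation $\phi$: $Z(\Phi)$ is the real number $\lambda$ such that $\lim_n |{}^n\phi(x)|/n = \lambda$ for all $x \in X$, if it exists; $D(\Phi)$ is the smallest $D \in \mathbb{N}$ such that $|{}^n\phi(x)| \in [Z(\Phi)n - D, Z(\Phi)n + D]$ for all $x \in X$, $n \in \mathbb{N}$, if it exists; and $I(\Phi) = \min\{R \in \mathbb{N} \mid \forall x,y \in X: x_{[0,R]} = y_{[0,R]} \implies \phi(x) = \phi(y)\}$. $\Phi$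 has balanced growth if $Z(\Phi)$ and $D(\Phi)$ are well-defined. Almost inverses. For dill maps $\Phi, \Psi : X \to Y$ with $X$ uniformly recurrent (minimal), $\Phi \sim \Psi$ means: for all $x \in X$ there are $i, j \in \mathbb{N}$ with $\sigma^i(\Phi(x)) = \sigma^j(\Psi(x))$. An almost inverse of a dill map $\Phi_1 : X \to Y$ is a dill map $\Phi_2 : Y \to X$ with $\Phi_2 \circ \Phi_1 \sim \mathrm{id}_X$ and $\Phi_1 \circ \Phi_2 \sim \mathrm{id}_Y$. Every primitive aperiodic substitution with balanced growth has an almost inverse with balanced growth. *)

theory Defs
  imports "HOL-Analysis.Analysis" "HOL-Library.Sublist"
begin

text \<open>An alphabet is a finite type \<open>'a\<close>. Infinite words are functions on \<open>nat\<close>; maps between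
  subshifts are total functions of which only the values on the domain subshift matter.\<close>

definition full_shift :: "(nat \<Rightarrow> 'a) topology" where
  "full_shift = product_topology (\<lambda>_. discrete_topology UNIV) UNIV"

definition shift :: "(nat \<Rightarrow> 'a) \<Rightarrow> nat \<Rightarrow> 'a" where
  "shift x = (\<lambda>i. x (Suc i))"

definition subshift :: "(nat \<Rightarrow> 'a) set \<Rightarrow> bool" where
  "subshift X \<longleftrightarrow> closedin full_shift X \<and> shift ` X \<subseteq> X"

definition shift_periodic :: "(nat \<Rightarrow> 'a) \<Rightarrow> bool" where
  "shift_periodic x \<longleftrightarrow> (\<exists>p>0. (shift ^^ p) x = x)"

definition block_map ::
    "(nat \<Rightarrow> 'a) set \<Rightarrow> (nat \<Rightarrow> 'b) set \<Rightarrow> ((nat \<Rightarrow> 'a) \<Rightarrow> nat \<Rightarrow> 'b) \<Rightarrow> bool" where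
  "block_map X Y f \<longleftrightarrow> subshift X \<and> subshift Y \<and>
     continuous_map (subtopology full_shift X) (subtopology full_shift Y) f \<and>
     (\<forall>x\<in>X. f (shift x) = shift (f x))"

text \<open>The infinite word \<open>w 0 @ w 1 @ w 2 @ \<dots>\<close>; it is meaningful only if the total length is
  infinite, and unspecified beyond the total length otherwise.\<close>

definition infinite_length :: "(nat \<Rightarrow> 'a list) \<Rightarrow> bool" where
  "infinite_length w \<longleftrightarrow> (\<forall>k. \<exists>n. k < length (concat (map w [0..<n])))"

definition inf_concat :: "(nat \<Rightarrow> 'a list) \<Rightarrow> nat \<Rightarrow> 'a" where
  "inf_concat w k =
     (let n = (LEAST n. k < length (concat (map w [0..<n]))) in concat (map w [0..<n]) ! k)"

definition substitution :: "('a list \<Rightarrow> 'a list) \<Rightarrow> bool" where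
  "substitution \<tau> \<longleftrightarrow> (\<forall>u v. \<tau> (u @ v) = \<tau> u @ \<tau> v)"

definition subst_shift :: "('a list \<Rightarrow> 'a list) \<Rightarrow> (nat \<Rightarrow> 'a) set" where
  "subst_shift \<tau> = {x. \<forall>i j. \<exists>a n. sublist (map x [i..<j]) ((\<tau> ^^ n) [a])}"

definition subst_act :: "('a list \<Rightarrow> 'a list) \<Rightarrow> (nat \<Rightarrow> 'a) \<Rightarrow> nat \<Rightarrow> 'a" where
  "subst_act \<tau> x = inf_concat (\<lambda>i. \<tau> [x i])"

definition primitive :: "('a list \<Rightarrow> 'a list) \<Rightarrow> bool" where
  "primitive \<tau> \<longleftrightarrow> (\<forall>a b. \<forall>\<^sub>F n in sequentially. sublist [a] ((\<tau> ^^ n) [b]))"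

definition aperiodic :: "('a list \<Rightarrow> 'a list) \<Rightarrow> bool" where
  "aperiodic \<tau> \<longleftrightarrow> (\<forall>x\<in>subst_shift \<tau>. \<not> shift_periodic x)"

definition dill_map ::
    "(nat \<Rightarrow> 'a) set \<Rightarrow> (nat \<Rightarrow> 'b) set \<Rightarrow> ((nat \<Rightarrow> 'a) \<Rightarrow> nat \<Rightarrow> 'b) \<Rightarrow> bool" where
  "dill_map X Y \<Phi> \<longleftrightarrow> subshift X \<and> subshift Y \<and>
     continuous_map (subtopology full_shift X) (subtopology full_shift Y) \<Phi> \<and>
     (\<exists>s :: (nat \<Rightarrow> 'a) \<Rightarrow> nat.
        continuous_map (subtopology full_shift X) (discrete_topology UNIV) s \<and>
        (\<forall>x\<in>X. \<Phi> (shift x) = (shift ^^ s x) (\<Phi> x)) \<and>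
        (\<forall>x\<in>X. \<exists>n. s ((shift ^^ n) x) > 0))"

definition implements ::
    "(nat \<Rightarrow> 'a) set \<Rightarrow> ((nat \<Rightarrow> 'a) \<Rightarrow> nat \<Rightarrow> 'b) \<Rightarrow> ((nat \<Rightarrow> 'a) \<Rightarrow> 'b list) \<Rightarrow> bool" where
  "implements X \<Phi> \<phi> \<longleftrightarrow>
     continuous_map (subtopology full_shift X) (discrete_topology UNIV) \<phi> \<and>
     (\<forall>x\<in>X. infinite_length (\<lambda>n. \<phi> ((shift ^^ n) x)) \<and>
             \<Phi> x = inf_concat (\<lambda>n. \<phi> ((shift ^^ n) x)))"

text \<open>For a dill map into a subshift without periodic points there is exactly one implementation
  as a function on \<open>X\<close>; \<open>extensional X\<close> fixes the irrelevant values outside \<open>X\<close>.\<close>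

definition implementation ::
    "(nat \<Rightarrow> 'a) set \<Rightarrow> ((nat \<Rightarrow> 'a) \<Rightarrow> nat \<Rightarrow> 'b) \<Rightarrow> (nat \<Rightarrow> 'a) \<Rightarrow> 'b list" where
  "implementation X \<Phi> = (THE \<phi>. \<phi> \<in> extensional X \<and> implements X \<Phi> \<phi>)"

definition impl_iter :: "((nat \<Rightarrow> 'a) \<Rightarrow> 'b list) \<Rightarrow> nat \<Rightarrow> (nat \<Rightarrow> 'a) \<Rightarrow> 'b list" where
  "impl_iter \<phi> n x = concat (map (\<lambda>i. \<phi> ((shift ^^ i) x)) [0..<n])"

definition has_growth_rate ::
    "(nat \<Rightarrow> 'a) set \<Rightarrow> ((nat \<Rightarrow> 'a) \<Rightarrow> nat \<Rightarrow> 'b) \<Rightarrow> real \<Rightarrow> bool" where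
  "has_growth_rate X \<Phi> l \<longleftrightarrow>
     (\<forall>x\<in>X. (\<lambda>n. real (length (impl_iter (implementation X \<Phi>) n x)) / real n) \<longlonglongrightarrow> l)"

text \<open>The invariants \<open>Z\<close>, \<open>D\<close> and \<open>I\<close> are \<open>growth_rate\<close>, \<open>discrepancy\<close> and \<open>impl_radius\<close>.\<close>

definition growth_rate :: "(nat \<Rightarrow> 'a) set \<Rightarrow> ((nat \<Rightarrow> 'a) \<Rightarrow> nat \<Rightarrow> 'b) \<Rightarrow> real" where
  "growth_rate X \<Phi> = (THE l. has_growth_rate X \<Phi> l)"

definition discrepancy_bound ::
    "(nat \<Rightarrow> 'a) set \<Rightarrow> ((nat \<Rightarrow> 'a) \<Rightarrow> nat \<Rightarrow> 'b) \<Rightarrow> nat \<Rightarrow> bool" where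
  "discrepancy_bound X \<Phi> D \<longleftrightarrow>
     (\<forall>x\<in>X. \<forall>n. real (length (impl_iter (implementation X \<Phi>) n x))
        \<in> {growth_rate X \<Phi> * real n - real D .. growth_rate X \<Phi> * real n + real D})"

definition discrepancy :: "(nat \<Rightarrow> 'a) set \<Rightarrow> ((nat \<Rightarrow> 'a) \<Rightarrow> nat \<Rightarrow> 'b) \<Rightarrow> nat" where
  "discrepancy X \<Phi> = (LEAST D. discrepancy_bound X \<Phi> D)"

text \<open>For a dill map into a subshift without periodic points, such an \<open>R\<close> exists by compactness.\<close>

definition impl_radius :: "(nat \<Rightarrow> 'a) set \<Rightarrow> ((nat \<Rightarrow> 'a) \<Rightarrow> nat \<Rightarrow> 'b) \<Rightarrow> nat" where
  "impl_radius X \<Phi> = (LEAST R. \<forall>x\<in>X. \<forall>y\<in>X.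
     (\<forall>i\<le>R. x i = y i) \<longrightarrow> implementation X \<Phi> x = implementation X \<Phi> y)"

text \<open>Uniqueness of the growth rate is automatic unless \<open>X\<close> is empty.\<close>

definition balanced_growth :: "(nat \<Rightarrow> 'a) set \<Rightarrow> ((nat \<Rightarrow> 'a) \<Rightarrow> nat \<Rightarrow> 'b) \<Rightarrow> bool" where
  "balanced_growth X \<Phi> \<longleftrightarrow> (\<exists>!l. has_growth_rate X \<Phi> l) \<and> (\<exists>D. discrepancy_bound X \<Phi> D)"

text \<open>Intended for minimal \<open>X\<close>, which includes the subshifts of primitive substitutions.\<close>

definition almost_equal ::
    "(nat \<Rightarrow> 'a) set \<Rightarrow> ((nat \<Rightarrow> 'a) \<Rightarrow> nat \<Rightarrow> 'b) \<Rightarrow> ((nat \<Rightarrow> 'a) \<Rightarrow> nat \<Rightarrow> 'b) \<Rightarrow> bool" where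
  "almost_equal X \<Phi> \<Psi> \<longleftrightarrow> (\<forall>x\<in>X. \<exists>i j. (shift ^^ i) (\<Phi> x) = (shift ^^ j) (\<Psi> x))"

definition almost_inverse ::
    "(nat \<Rightarrow> 'a) set \<Rightarrow> (nat \<Rightarrow> 'b) set \<Rightarrow> ((nat \<Rightarrow> 'a) \<Rightarrow> nat \<Rightarrow> 'b) \<Rightarrow>
     ((nat \<Rightarrow> 'b) \<Rightarrow> nat \<Rightarrow> 'a) \<Rightarrow> bool" where
  "almost_inverse X Y \<Phi>\<^sub>1 \<Phi>\<^sub>2 \<longleftrightarrow> dill_map Y X \<Phi>\<^sub>2 \<and>
     almost_equal X (\<Phi>\<^sub>2 \<circ> \<Phi>\<^sub>1) id \<and> almost_equal Y (\<Phi>\<^sub>1 \<circ> \<Phi>\<^sub>2) id"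

end

theory Submission
  imports Defs
begin

text \<open>For a dill map \<open>\<Phi>\<close> with cocycle \<open>S\<^sub>\<Phi>(n, x) = s(x) + \<dots> + s(\<sigma>\<^sup>n\<^sup>-\<^sup>1 x)\<close> one has
  \<open>\<Phi>(\<sigma>\<^sup>n x) = \<sigma>\<^sup>m(\<Phi> x)\<close> for \<open>m = S\<^sub>\<Phi>(n, x)\<close>, and the implementation reads off the first \<open>s(x)\<close>
  letters of \<open>\<Phi> x\<close>. From \<open>S\<^sub>\<Psi>\<^sub>\<circ>\<^sub>\<Phi>(n, x) = S\<^sub>\<Psi>(S\<^sub>\<Phi>(n, x), \<Phi> x)\<close> one gets
  \<open>D(\<Psi> \<circ> \<Phi>) \<le> D(\<Psi>) + Z(\<Psi>) D(\<Phi>)\<close> and \<open>I(\<Psi> \<circ> \<Phi>) \<le> I(\<Phi>) + \<lceil>(I(\<Psi>) + D(\<Phi>)) / Z(\<Phi>)\<rceil>\<close>.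
  With \<open>Z(\<rho>\<^sup>-\<^sup>1) = 1/\<lambda>\<close> these recursions are geometric: \<open>D(\<tau>\<^sup>i)\<close> and \<open>I(\<rho>\<^sup>-\<^sup>i)\<close> are \<open>O(\<lambda>\<^sup>i)\<close> while
  \<open>D(\<rho>\<^sup>-\<^sup>i)\<close> stays bounded, and in \<open>\<rho>\<^sup>-\<^sup>i \<circ> f \<circ> \<tau>\<^sup>i\<close> the \<open>O(\<lambda>\<^sup>i)\<close> terms are divided by \<open>\<lambda>\<^sup>i\<close>, as is
  the only contribution of \<open>f\<close>, its radius. That \<open>Z(\<rho>\<^sup>-\<^sup>1) = 1/\<lambda>\<close> is where the almost inverse enters: the map
  \<open>\<rho>\<^sup>-\<^sup>1 \<circ> \<rho> \<sim> id\<close> is aligned with the identity by constant shifts on some cylinder, by Baire's theorem,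
  and orbits return to cylinders infinitely often.\<close>

section \<open>The topology of shift spaces\<close>

text \<open>The strict bound makes \<open>n\<close> a prefix length: \<open>{y. agree n x y}\<close>
  is the cylinder given by the first \<open>n\<close> letters of \<open>x\<close>, and
  \<open>agree 0\<close> always holds.\<close>

definition agree :: "nat \<Rightarrow> (nat \<Rightarrow> 'a) \<Rightarrow> (nat \<Rightarrow> 'a) \<Rightarrow> bool" where
  "agree n x y \<longleftrightarrow> (\<forall>i<n. x i = y i)"

lemma agree_refl [simp]: "agree n x x"
  by (simp add: agree_def)

lemma agree_trans: "agree n x y \<Longrightarrow> agree n y z \<Longrightarrow> agree n x z"
  by (simp add: agree_def)

lemma agree_mono: "agree n x y \<Longrightarrow> m \<le> n \<Longrightarrow> agree m x y"
  by (simp add: agree_def)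

lemma agree_Suc: "agree (Suc n) x y \<longleftrightarrow> agree n x y \<and> x n = y n"
  by (auto simp: agree_def less_Suc_eq)

lemma shift_funpow: "(shift ^^ n) x = (\<lambda>i. x (i + n))"
  by (induction n arbitrary: x) (simp_all add: funpow_Suc_right shift_def del: funpow.simps)

lemma shift_shift: "(shift ^^ m) ((shift ^^ n) x) = (shift ^^ (m + n)) x"
  by (simp add: funpow_add)

lemma agree_shift: "agree (m + n) x y \<Longrightarrow> agree n ((shift ^^ m) x) ((shift ^^ m) y)"
  by (simp add: agree_def shift_funpow)

text \<open>The one-sided shift is not injective, so two equal shifts of \<open>x\<close> make only
  a shift of \<open>x\<close> periodic, not \<open>x\<close> itself.\<close>

lemma shift_periodicI:
  assumes "(shift ^^ m) x = (shift ^^ n) x" "m < n"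
  shows "shift_periodic ((shift ^^ m) x)"
proof -
  have "(shift ^^ (n - m)) ((shift ^^ m) x) = (shift ^^ n) x"
    unfolding shift_shift using assms(2) by simp
  also have "\<dots> = (shift ^^ m) x"
    using assms(1) by simp
  finally have "(shift ^^ (n - m)) ((shift ^^ m) x) = (shift ^^ m) x" .
  then show ?thesis
    using assms(2) by (auto simp: shift_periodic_def intro!: exI[of _ "n - m"])
qed

lemma topspace_full_shift [simp]: "topspace full_shift = UNIV"
  by (simp add: full_shift_def)

text \<open>A basic open set of the product restricts finitely many coordinates, so a cylinder long
  enough to cover them fits inside; conversely, a cylinder is itself a basic open set.\<close>

lemma openin_full_shift: "openin full_shift U \<longleftrightarrow> (\<forall>x\<in>U. \<exists>N. \<forall>y. agree N x y \<longrightarrow> y \<in> U)"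
proof
  assume U: "openin full_shift U"
  show "\<forall>x\<in>U. \<exists>N. \<forall>y. agree N x y \<longrightarrow> y \<in> U"
  proof
    fix x assume "x \<in> U"
    then obtain V where V: "finite {i. V i \<noteq> UNIV}" "x \<in> Pi\<^sub>E UNIV V" "Pi\<^sub>E UNIV V \<subseteq> U"
      using U unfolding full_shift_def openin_product_topology_alt by auto
    obtain N where N: "\<forall>i\<in>{i. V i \<noteq> UNIV}. i < N"
      using finite_nat_set_iff_bounded V(1) by blast
    have "y \<in> U" if "agree N x y" for y
    proof -
      have "y i \<in> V i" for i
      proof (cases "V i = UNIV")
        case False
        then have "y i = x i" using that N by (simp add: agree_def)
        then show ?thesis using V(2) by (auto simp: PiE_iff)
      qed simp
      then show ?thesis
        using V(3) by (auto simp: PiE_iff)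
    qed
    then show "\<exists>N. \<forall>y. agree N x y \<longrightarrow> y \<in> U" by blast
  qed
next
  assume *: "\<forall>x\<in>U. \<exists>N. \<forall>y. agree N x y \<longrightarrow> y \<in> U"
  show "openin full_shift U"
    unfolding full_shift_def openin_product_topology_alt
  proof
    fix x assume "x \<in> U"
    then obtain N where N: "\<And>y. agree N x y \<Longrightarrow> y \<in> U" using * by blast
    define V where "V = (\<lambda>i. if i < N then {x i} else UNIV)"
    have "finite {i \<in> UNIV. V i \<noteq> topspace (discrete_topology UNIV)}"
      by (rule finite_subset[of _ "{..<N}"]) (auto simp: V_def)
    moreover have "Pi\<^sub>E UNIV V \<subseteq> U"
      using N by (force simp: V_def agree_def PiE_iff split: if_splits)
    ultimately show "\<exists>V. finite {i \<in> UNIV. V i \<noteq> topspace (discrete_topology UNIV)} \<and>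
        (\<forall>i\<in>UNIV. openin (discrete_topology UNIV) (V i)) \<and> x \<in> Pi\<^sub>E UNIV V \<and> Pi\<^sub>E UNIV V \<subseteq> U"
      by (intro exI[of _ V]) (auto simp: V_def)
  qed
qed

lemma openin_cylinder: "openin full_shift {y. agree N x y}"
  unfolding openin_full_shift by (blast intro: agree_trans)

lemma closedin_full_shift:
  "closedin full_shift X \<longleftrightarrow> (\<forall>x. (\<forall>N. \<exists>y\<in>X. agree N x y) \<longrightarrow> x \<in> X)"
proof -
  have "closedin full_shift X \<longleftrightarrow> (\<forall>x. x \<notin> X \<longrightarrow> (\<exists>N. \<forall>y. agree N x y \<longrightarrow> y \<notin> X))"
    by (auto simp add: closedin_def openin_full_shift)
  then show ?thesis by metis
qed

lemma Hausdorff_full_shift: "Hausdorff_space full_shift"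
  by (simp add: full_shift_def Hausdorff_space_product_topology)

lemma compact_full_shift: "compact_space (full_shift :: (nat \<Rightarrow> 'a::finite) topology)"
  by (simp add: full_shift_def compact_space_product_topology compact_space_discrete_topology)

lemma compactin_subshift:
  fixes X :: "(nat \<Rightarrow> 'a::finite) set"
  assumes "subshift X" shows "compactin full_shift X"
  using assms closedin_compact_space compact_full_shift by (auto simp: subshift_def)

lemma continuous_map_discrete_iff:
  "continuous_map (subtopology full_shift X) (discrete_topology UNIV) g \<longleftrightarrow>
    (\<forall>x\<in>X. \<exists>N. \<forall>y\<in>X. agree N x y \<longrightarrow> g x = g y)"
proof
  assume g: "continuous_map (subtopology full_shift X) (discrete_topology UNIV) g"
  show "\<forall>x\<in>X. \<exists>N. \<forall>y\<in>X. agree N x y \<longrightarrow> g x = g y"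
  proof
    fix x assume x: "x \<in> X"
    have "openin (subtopology full_shift X) {y \<in> X. g y \<in> {g x}}"
      using openin_continuous_map_preimage[OF g, of "{g x}"] by simp
    then obtain U where U: "openin full_shift U" "{y \<in> X. g y \<in> {g x}} = U \<inter> X"
      unfolding openin_subtopology by blast
    then have "x \<in> U" using x by blast
    then obtain N where "\<And>y. agree N x y \<Longrightarrow> y \<in> U"
      using U(1) unfolding openin_full_shift by blast
    then have "\<forall>y\<in>X. agree N x y \<longrightarrow> y \<in> {y \<in> X. g y \<in> {g x}}"
      unfolding U(2) by blast
    then show "\<exists>N. \<forall>y\<in>X. agree N x y \<longrightarrow> g x = g y"
      by (intro exI[of _ N]) auto
  qed
next
  assume *: "\<forall>x\<in>X. \<exists>N. \<forall>y\<in>X. agree N x y \<longrightarrow> g x = g y"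
  have "openin (subtopology full_shift X) {x \<in> X. g x \<in> U}" for U
    unfolding openin_subopen[of _ "{x \<in> X. g x \<in> U}"]
  proof
    fix x assume "x \<in> {x \<in> X. g x \<in> U}"
    then obtain N where N: "\<forall>y\<in>X. agree N x y \<longrightarrow> g x = g y" "x \<in> X" "g x \<in> U"
      using * by blast
    have "openin (subtopology full_shift X) (X \<inter> {y. agree N x y})"
      by (intro openin_subtopology_Int2 openin_cylinder)
    moreover have "X \<inter> {y. agree N x y} \<subseteq> {x \<in> X. g x \<in> U}"
    proof
      fix y assume "y \<in> X \<inter> {y. agree N x y}"
      then have "y \<in> X" "g x = g y" using N(1) by blast+
      then show "y \<in> {x \<in> X. g x \<in> U}" using N(3) by simp
    qed
    ultimately show "\<exists>T. openin (subtopology full_shift X) T \<and> x \<in> T \<and> T \<subseteq> {x \<in> X. g x \<in> U}"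
      using N(2) by (intro exI[of _ "X \<inter> {y. agree N x y}"]) auto
  qed
  then show "continuous_map (subtopology full_shift X) (discrete_topology UNIV) g"
    by (simp add: continuous_map_def)
qed

text \<open>Compactness: finitely many cylinders on which \<open>g\<close> is constant cover
  \<open>X\<close>, and two points that agree beyond all their lengths lie in a common one.\<close>

lemma continuous_map_discrete_uniform:
  fixes X :: "(nat \<Rightarrow> 'a::finite) set"
  assumes "subshift X"
  shows "continuous_map (subtopology full_shift X) (discrete_topology UNIV) g \<longleftrightarrow>
    (\<exists>N. \<forall>x\<in>X. \<forall>y\<in>X. agree N x y \<longrightarrow> g x = g y)"
  unfolding continuous_map_discrete_iff
proof
  assume "\<forall>x\<in>X. \<exists>N. \<forall>y\<in>X. agree N x y \<longrightarrow> g x = g y"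
  then obtain N where N: "\<And>x y. x \<in> X \<Longrightarrow> y \<in> X \<Longrightarrow> agree (N x) x y \<Longrightarrow> g x = g y"
    by metis
  define \<U> where "\<U> = (\<lambda>x. {y. agree (N x) x y}) ` X"
  have "\<forall>U\<in>\<U>. openin full_shift U" "X \<subseteq> \<Union>\<U>"
    by (auto simp: \<U>_def openin_cylinder)
  then have "\<exists>\<F>. finite \<F> \<and> \<F> \<subseteq> \<U> \<and> X \<subseteq> \<Union>\<F>"
    using compactin_subshift[OF assms] unfolding compactin_def by (elim conjE allE[of _ \<U>]) simp
  then obtain \<F> where \<F>: "finite \<F>" "\<F> \<subseteq> \<U>" "X \<subseteq> \<Union>\<F>" by blast
  obtain F where F: "finite F" "F \<subseteq> X" "\<F> = (\<lambda>x. {y. agree (N x) x y}) ` F"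
    using finite_subset_image[OF \<F>(1) \<F>(2)[unfolded \<U>_def]] by blast
  \<comment> \<open>The sum serves as a common upper bound of the lengths; unlike a maximum it also
    makes sense for empty \<open>F\<close>.\<close>
  have "g x = g y" if xy: "x \<in> X" "y \<in> X" "agree (\<Sum>z\<in>F. N z) x y" for x y
  proof -
    obtain z where z: "z \<in> F" "agree (N z) z x"
      using \<F>(3) F(3) xy(1) by blast
    have "N z \<le> (\<Sum>z\<in>F. N z)"
      using z(1) F(1) by (simp add: member_le_sum)
    then have "agree (N z) z y"
      using agree_trans[OF z(2)] agree_mono xy(3) by blast
    then show ?thesis
      using N z xy F(2) by (metis subsetD)
  qed
  then show "\<exists>N. \<forall>x\<in>X. \<forall>y\<in>X. agree N x y \<longrightarrow> g x = g y"
    by blast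
qed blast

lemma continuous_map_shift_spaces:
  "continuous_map (subtopology full_shift X) (subtopology full_shift Y) \<Phi> \<longleftrightarrow> \<Phi> ` X \<subseteq> Y \<and>
    (\<forall>k. continuous_map (subtopology full_shift X) (discrete_topology UNIV) (\<lambda>x. \<Phi> x k))"
proof -
  have "continuous_map T full_shift \<Phi> \<longleftrightarrow> (\<forall>k. continuous_map T (discrete_topology UNIV) (\<lambda>x. \<Phi> x k))" for T
    by (simp add: full_shift_def continuous_map_componentwise_UNIV)
  then show ?thesis
    unfolding continuous_map_in_subtopology by (simp add: image_subset_iff_funcset conj_commute)
qed

lemma continuous_map_shift: "continuous_map full_shift full_shift shift"
  unfolding full_shift_def continuous_map_componentwise_UNIV shift_def
  by (intro allI continuous_map_product_projection UNIV_I)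

lemma continuous_map_shift_funpow: "continuous_map full_shift full_shift (shift ^^ n)"
proof (induction n)
  case (Suc n)
  then show ?case
    unfolding funpow.simps by (rule continuous_map_compose[OF _ continuous_map_shift])
qed (unfold funpow.simps, rule continuous_map_id)

section \<open>Dill maps and their cocycles\<close>

definition blocks :: "(nat \<Rightarrow> 'a list) \<Rightarrow> nat \<Rightarrow> 'a list" where
  "blocks w n = concat (map w [0..<n])"

lemma blocks_0 [simp]: "blocks w 0 = []"
  by (simp add: blocks_def)

lemma blocks_Suc [simp]: "blocks w (Suc n) = blocks w n @ w n"
  by (simp add: blocks_def)

lemma blocks_Suc_left: "blocks w (Suc n) = w 0 @ blocks (\<lambda>i. w (Suc i)) n"
  by (induction n) simp_all

lemma prefix_blocks: "m \<le> n \<Longrightarrow> prefix (blocks w m) (blocks w n)"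
  by (induction n rule: dec_induct) (auto intro: prefix_order.trans)

text \<open>Later partial concatenations extend earlier ones, so the least index in
  \<open>inf_concat\<close> may be replaced by any index that is large enough.\<close>

lemma inf_concat_nth:
  assumes "k < length (blocks w n)"
  shows "inf_concat w k = blocks w n ! k"
proof -
  define m where "m = (LEAST m. k < length (blocks w m))"
  have "k < length (blocks w m)" "m \<le> n"
    unfolding m_def using assms by (auto intro: LeastI Least_le)
  then have "blocks w m ! k = blocks w n ! k"
    using prefix_blocks[of m n w] by (auto simp: prefix_def nth_append)
  then show ?thesis
    by (simp add: inf_concat_def m_def blocks_def Let_def)
qed

lemma map_inf_concat: "map (inf_concat w) [0..<length (blocks w n)] = blocks w n"
  by (rule nth_equalityI) (auto simp: inf_concat_nth)

lemma inf_concat_eqI: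
  assumes "infinite_length w" "\<And>n. blocks w n = map y [0..<length (blocks w n)]"
  shows "inf_concat w = y"
proof
  fix k
  obtain n where n: "k < length (blocks w n)"
    using assms(1) by (auto simp: infinite_length_def blocks_def)
  then have "inf_concat w k = map y [0..<length (blocks w n)] ! k"
    using assms(2)[of n] by (simp add: inf_concat_nth)
  then show "inf_concat w k = y k" using n by simp
qed

lemma shift_inf_concat:
  assumes "infinite_length w"
  shows "(shift ^^ length (w 0)) (inf_concat w) = inf_concat (\<lambda>i. w (Suc i))"
proof
  fix k
  obtain n where n: "k + length (w 0) < length (blocks w n)"
    using assms unfolding infinite_length_def blocks_def by blast
  then have n': "k + length (w 0) < length (blocks w (Suc n))"
    by simp
  then have "(shift ^^ length (w 0)) (inf_concat w) k = blocks w (Suc n) ! (k + length (w 0))"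
    unfolding shift_funpow by (rule inf_concat_nth)
  also have "\<dots> = blocks (\<lambda>i. w (Suc i)) n ! k"
    by (simp add: blocks_Suc_left nth_append del: blocks_Suc)
  also have "\<dots> = inf_concat (\<lambda>i. w (Suc i)) k"
    using n' by (intro inf_concat_nth[symmetric]) (simp add: blocks_Suc_left del: blocks_Suc)
  finally show "(shift ^^ length (w 0)) (inf_concat w) k = inf_concat (\<lambda>i. w (Suc i)) k" .
qed

text \<open>\<open>dill_map\<close> with the witness \<open>s\<close> as a parameter, since all
  later estimates are computed from a concrete cocycle.\<close>

definition dill_cocycle ::
    "(nat \<Rightarrow> 'a) set \<Rightarrow> (nat \<Rightarrow> 'b) set \<Rightarrow> ((nat \<Rightarrow> 'a) \<Rightarrow> nat \<Rightarrow> 'b) \<Rightarrow> ((nat \<Rightarrow> 'a) \<Rightarrow> nat) \<Rightarrow> bool" where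
  "dill_cocycle X Y \<Phi> s \<longleftrightarrow> subshift X \<and> subshift Y \<and>
     continuous_map (subtopology full_shift X) (subtopology full_shift Y) \<Phi> \<and>
     continuous_map (subtopology full_shift X) (discrete_topology UNIV) s \<and>
     (\<forall>x\<in>X. \<Phi> (shift x) = (shift ^^ s x) (\<Phi> x)) \<and>
     (\<forall>x\<in>X. \<exists>n. s ((shift ^^ n) x) > 0)"

lemma dill_map_iff: "dill_map X Y \<Phi> \<longleftrightarrow> (\<exists>s. dill_cocycle X Y \<Phi> s)"
  by (auto simp: dill_map_def dill_cocycle_def)

definition aperiodic_shift :: "(nat \<Rightarrow> 'a) set \<Rightarrow> bool" where
  "aperiodic_shift X \<longleftrightarrow> (\<forall>x\<in>X. \<not> shift_periodic x)"

text \<open>The cocycle \<open>S\<^sub>\<Phi>(n, x)\<close>: for \<open>s\<close> belonging to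
  \<open>\<Phi>\<close>, the number of letters of \<open>\<Phi> x\<close> consumed by the first
  \<open>n\<close> shifts of \<open>x\<close>.\<close>

definition step_sum :: "((nat \<Rightarrow> 'a) \<Rightarrow> nat) \<Rightarrow> nat \<Rightarrow> (nat \<Rightarrow> 'a) \<Rightarrow> nat" where
  "step_sum s n x = (\<Sum>i<n. s ((shift ^^ i) x))"

lemma step_sum_0 [simp]: "step_sum s 0 x = 0"
  by (simp add: step_sum_def)

lemma step_sum_Suc: "step_sum s (Suc n) x = step_sum s n x + s ((shift ^^ n) x)"
  by (simp add: step_sum_def)

lemma step_sum_1 [simp]: "step_sum s (Suc 0) x = s x"
  by (simp add: step_sum_def)

lemma step_sum_add: "step_sum s (m + n) x = step_sum s m x + step_sum s n ((shift ^^ m) x)"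
  by (induction n) (simp_all add: step_sum_Suc shift_shift add.commute)

lemma step_sum_mono: "m \<le> n \<Longrightarrow> step_sum s m x \<le> step_sum s n x"
  unfolding step_sum_def by (rule sum_mono2) auto

lemma subshift_shift: "subshift X \<Longrightarrow> x \<in> X \<Longrightarrow> (shift ^^ n) x \<in> X"
  by (induction n) (auto simp: subshift_def)

text \<open>Two different exponents would produce a periodic point in the orbit of \<open>x\<close>.
  This is how lengths are recovered from equalities between shifted points.\<close>

lemma aperiodic_shift_inj:
  assumes "subshift X" "aperiodic_shift X" "x \<in> X" "(shift ^^ m) x = (shift ^^ n) x"
  shows "m = n"
  using shift_periodicI[of m x n] shift_periodicI[of n x m] assms subshift_shift
  unfolding aperiodic_shift_def by (metis nat_neq_iff)

lemma dill_cocycle_mem: "dill_cocycle X Y \<Phi> s \<Longrightarrow> x \<in> X \<Longrightarrow> \<Phi> x \<in> Y"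
  by (auto simp: dill_cocycle_def continuous_map_shift_spaces)

lemma dill_cocycle_shift:
  assumes "dill_cocycle X Y \<Phi> s" "x \<in> X"
  shows "\<Phi> ((shift ^^ n) x) = (shift ^^ step_sum s n x) (\<Phi> x)"
proof (induction n)
  case (Suc n)
  have "\<Phi> (shift ((shift ^^ n) x)) = (shift ^^ s ((shift ^^ n) x)) (\<Phi> ((shift ^^ n) x))"
    using assms subshift_shift by (auto simp: dill_cocycle_def)
  then show ?case
    using Suc by (simp add: step_sum_Suc shift_shift add.commute)
qed simp

text \<open>A positive step is required only once per orbit, but the requirement applies anew to
  every shifted point.\<close>

lemma step_sum_unbounded:
  assumes "dill_cocycle X Y \<Phi> s" "x \<in> X"
  shows "\<exists>n. k < step_sum s n x"
proof (induction k)
  case 0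
  obtain n where "s ((shift ^^ n) x) > 0"
    using assms by (auto simp: dill_cocycle_def)
  then show ?case
    by (intro exI[of _ "Suc n"]) (simp add: step_sum_Suc)
next
  case (Suc k)
  then obtain n where n: "k < step_sum s n x" by blast
  obtain j where "s ((shift ^^ j) ((shift ^^ n) x)) > 0"
    using assms subshift_shift[of X x n] by (auto simp: dill_cocycle_def)
  then have "0 < step_sum s (Suc j) ((shift ^^ n) x)"
    by (simp add: step_sum_Suc)
  then show ?case
    using n by (intro exI[of _ "n + Suc j"]) (simp only: step_sum_add)
qed

lemma map_upt_shift:
  "map y [0..<a] @ map ((shift ^^ a) y) [0..<b] = map y [0..<a + b]"
  by (rule nth_equalityI) (auto simp: nth_append shift_funpow)

lemma blocks_dill_cocycle:
  assumes "dill_cocycle X Y \<Phi> s" "x \<in> X"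
  shows "blocks (\<lambda>i. map (\<Phi> ((shift ^^ i) x)) [0..<s ((shift ^^ i) x)]) n = map (\<Phi> x) [0..<step_sum s n x]"
  by (induction n) (simp_all add: step_sum_Suc dill_cocycle_shift[OF assms] map_upt_shift)

section \<open>Uniform continuity and radii\<close>

lemma uniform_map:
  fixes X :: "(nat \<Rightarrow> 'a::finite) set"
  assumes "subshift X" "continuous_map (subtopology full_shift X) (subtopology full_shift Y) \<Phi>"
  shows "\<exists>N. \<forall>x\<in>X. \<forall>y\<in>X. agree N x y \<longrightarrow> agree n (\<Phi> x) (\<Phi> y)"
proof (induction n)
  case (Suc n)
  then obtain N where N: "\<forall>x\<in>X. \<forall>y\<in>X. agree N x y \<longrightarrow> agree n (\<Phi> x) (\<Phi> y)" by blast
  have "\<exists>M. \<forall>x\<in>X. \<forall>y\<in>X. agree M x y \<longrightarrow> \<Phi> x n = \<Phi> y n"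
    using assms continuous_map_discrete_uniform[OF assms(1), of "\<lambda>x. \<Phi> x n"]
    unfolding continuous_map_shift_spaces by blast
  then obtain M where M: "\<forall>x\<in>X. \<forall>y\<in>X. agree M x y \<longrightarrow> \<Phi> x n = \<Phi> y n" by blast
  show ?case
  proof (intro exI ballI impI)
    fix x y assume "x \<in> X" "y \<in> X" "agree (max N M) x y"
    then show "agree (Suc n) (\<Phi> x) (\<Phi> y)"
      using N M agree_mono unfolding agree_Suc by (meson max.cobounded1 max.cobounded2)
  qed
qed (simp add: agree_def)

lemma uniform_step:
  fixes X :: "(nat \<Rightarrow> 'a::finite) set"
  assumes "dill_cocycle X Y \<Phi> s"
  shows "\<exists>N. \<forall>x\<in>X. \<forall>y\<in>X. agree N x y \<longrightarrow> s x = s y"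
  using assms continuous_map_discrete_uniform unfolding dill_cocycle_def by blast

text \<open>For aperiodic targets this says \<open>I(\<Phi>) \<le> C\<close>; note that \<open>I\<close> counts from letter \<open>0\<close>, whence the
  \<open>Suc C\<close>.\<close>

definition step_radius ::
    "(nat \<Rightarrow> 'a) set \<Rightarrow> ((nat \<Rightarrow> 'a) \<Rightarrow> nat \<Rightarrow> 'b) \<Rightarrow> ((nat \<Rightarrow> 'a) \<Rightarrow> nat) \<Rightarrow> nat \<Rightarrow> bool" where
  "step_radius X \<Phi> s C \<longleftrightarrow>
     (\<forall>x\<in>X. \<forall>y\<in>X. agree (Suc C) x y \<longrightarrow> s x = s y \<and> agree (s x) (\<Phi> x) (\<Phi> y))"

text \<open>The length \<open>s x\<close> and the letters read are encoded in one word, which is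
  locally constant in \<open>x\<close> and hence, by compactness, determined by a prefix of uniform
  length.\<close>

lemma step_radius_exists:
  fixes X :: "(nat \<Rightarrow> 'a::finite) set"
  assumes "dill_cocycle X Y \<Phi> s"
  shows "\<exists>C. step_radius X \<Phi> s C"
proof -
  have X: "subshift X" using assms by (simp add: dill_cocycle_def)
  obtain N where N: "\<forall>x\<in>X. \<forall>y\<in>X. agree N x y \<longrightarrow> s x = s y"
    using uniform_step[OF assms] by blast
  have "\<forall>n. \<exists>M. \<forall>x\<in>X. \<forall>y\<in>X. agree M x y \<longrightarrow> agree n (\<Phi> x) (\<Phi> y)"
    using assms by (intro allI uniform_map) (auto simp: dill_cocycle_def)
  then obtain M where M: "\<And>n x y. x \<in> X \<Longrightarrow> y \<in> X \<Longrightarrow> agree (M n) x y \<Longrightarrow> agree n (\<Phi> x) (\<Phi> y)"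
    by metis
  have "\<exists>K. \<forall>y\<in>X. agree K x y \<longrightarrow> map (\<Phi> x) [0..<s x] = map (\<Phi> y) [0..<s y]" if x: "x \<in> X" for x
  proof (intro exI ballI impI)
    fix y assume y: "y \<in> X" "agree (max N (M (s x))) x y"
    then have "s x = s y" "agree (s x) (\<Phi> x) (\<Phi> y)"
      using N M[OF x, of y "s x"] x agree_mono by (meson max.cobounded1 max.cobounded2)+
    then show "map (\<Phi> x) [0..<s x] = map (\<Phi> y) [0..<s y]"
      by (auto simp: agree_def)
  qed
  then have "\<exists>K. \<forall>x\<in>X. \<forall>y\<in>X. agree K x y \<longrightarrow> map (\<Phi> x) [0..<s x] = map (\<Phi> y) [0..<s y]"
    using continuous_map_discrete_uniform[OF X, of "\<lambda>x. map (\<Phi> x) [0..<s x]"]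
    unfolding continuous_map_discrete_iff by blast
  then obtain K where K: "\<forall>x\<in>X. \<forall>y\<in>X. agree K x y \<longrightarrow> map (\<Phi> x) [0..<s x] = map (\<Phi> y) [0..<s y]"
    by blast
  have "step_radius X \<Phi> s K"
    unfolding step_radius_def
  proof (intro ballI impI)
    fix x y assume xy: "x \<in> X" "y \<in> X" "agree (Suc K) x y"
    then have eq: "map (\<Phi> x) [0..<s x] = map (\<Phi> y) [0..<s y]"
      using K agree_mono le_SucI by blast
    then have "s x = s y" by (metis length_map length_upt minus_nat.diff_0)
    then show "s x = s y \<and> agree (s x) (\<Phi> x) (\<Phi> y)"
      using eq by (auto simp: agree_def)
  qed
  then show ?thesis by blast
qed

text \<open>The step at time \<open>i\<close> looks at the letters \<open>i\<close> to
  \<open>i + C\<close>, so the windows of the first \<open>n\<close> steps end before position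
  \<open>n + C\<close>.\<close>

lemma step_radius_lag:
  assumes "dill_cocycle X Y \<Phi> s" "step_radius X \<Phi> s C" "x \<in> X" "y \<in> X" "agree (n + C) x y"
  shows "step_sum s n x = step_sum s n y \<and> agree (step_sum s n x) (\<Phi> x) (\<Phi> y)"
  using assms(5)
proof (induction n)
  case (Suc n)
  let ?x = "(shift ^^ n) x" and ?y = "(shift ^^ n) y"
  have X: "subshift X" using assms(1) by (simp add: dill_cocycle_def)
  have IH: "step_sum s n x = step_sum s n y" "agree (step_sum s n x) (\<Phi> x) (\<Phi> y)"
    using Suc.IH[OF agree_mono[OF Suc.prems, of "n + C"]] by (metis add_Suc le_SucI order_refl)+
  have "agree (Suc C) ?x ?y"
    using Suc.prems by (intro agree_shift) simp
  then have st: "s ?x = s ?y" "agree (s ?x) (\<Phi> ?x) (\<Phi> ?y)"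
    using assms(2-4) subshift_shift[OF X] unfolding step_radius_def by blast+
  have "\<Phi> x i = \<Phi> y i" if "i < step_sum s n x + s ?x" for i
  proof (cases "i < step_sum s n x")
    case False
    then have "\<Phi> ?x (i - step_sum s n x) = \<Phi> ?y (i - step_sum s n x)"
      using st(2) that by (simp add: agree_def)
    then show ?thesis
      unfolding dill_cocycle_shift[OF assms(1,3)] dill_cocycle_shift[OF assms(1,4)]
      using False IH(1) by (simp add: shift_funpow)
  qed (use IH(2) in \<open>simp add: agree_def\<close>)
  then show ?case
    using IH(1) st(1) by (simp add: step_sum_Suc agree_def)
qed (simp add: agree_def)

section \<open>Composition of dill maps and the chain rule for cocycles\<close>

lemma step_sum_compose:
  assumes "dill_cocycle X Y \<Phi> s" "x \<in> X"
  shows "step_sum (\<lambda>x. step_sum t (s x) (\<Phi> x)) n x = step_sum t (step_sum s n x) (\<Phi> x)"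
  by (induction n) (simp_all add: step_sum_Suc step_sum_add dill_cocycle_shift[OF assms])

text \<open>While \<open>\<Phi>\<close> makes one step at \<open>x\<close>, \<open>\<Psi>\<close>
  makes \<open>s x\<close> steps starting at \<open>\<Phi> x\<close>; their total is the cocycle of
  the composition.\<close>

lemma dill_cocycle_compose:
  fixes X :: "(nat \<Rightarrow> 'a::finite) set" and Y :: "(nat \<Rightarrow> 'b::finite) set"
  assumes \<Phi>: "dill_cocycle X Y \<Phi> s" and \<Psi>: "dill_cocycle Y Z \<Psi> t"
  shows "dill_cocycle X Z (\<Psi> \<circ> \<Phi>) (\<lambda>x. step_sum t (s x) (\<Phi> x))"
proof -
  let ?u = "\<lambda>x. step_sum t (s x) (\<Phi> x)"
  have X: "subshift X" and Y: "subshift Y" and Z: "subshift Z"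
    and c: "continuous_map (subtopology full_shift X) (subtopology full_shift Y) \<Phi>"
      "continuous_map (subtopology full_shift Y) (subtopology full_shift Z) \<Psi>"
    using \<Phi> \<Psi> by (auto simp: dill_cocycle_def)
  obtain N where N: "\<And>x y. x \<in> X \<Longrightarrow> y \<in> X \<Longrightarrow> agree N x y \<Longrightarrow> s x = s y"
    using uniform_step[OF \<Phi>] by blast
  obtain M where M: "\<And>x y. x \<in> Y \<Longrightarrow> y \<in> Y \<Longrightarrow> agree M x y \<Longrightarrow> t x = t y"
    using uniform_step[OF \<Psi>] by blast
  have "\<exists>K. \<forall>y\<in>X. agree K x y \<longrightarrow> ?u x = ?u y" if x: "x \<in> X" for x
  proof -
    \<comment> \<open>The values of \<open>t\<close> at the first \<open>s x\<close> points of the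
      orbit of \<open>\<Phi> x\<close> are fixed by its first \<open>s x + M\<close>
      letters.\<close>
    obtain L where L: "\<forall>x'\<in>X. \<forall>y\<in>X. agree L x' y \<longrightarrow> agree (s x + M) (\<Phi> x') (\<Phi> y)"
      using uniform_map[OF X c(1)] by blast
    have "?u x = ?u y" if y: "y \<in> X" "agree (max N L) x y" for y
    proof -
      have "s x = s y"
        using N[OF x y(1)] agree_mono[OF y(2)] by simp
      moreover have "agree (s x + M) (\<Phi> x) (\<Phi> y)"
        using L x y(1) agree_mono[OF y(2), of L] by simp
      then have "t ((shift ^^ i) (\<Phi> x)) = t ((shift ^^ i) (\<Phi> y))" if "i < s x" for i
        using that x y(1) agree_mono[of "s x + M" "\<Phi> x" "\<Phi> y" "i + M"]
        by (intro M agree_shift subshift_shift[OF Y] dill_cocycle_mem[OF \<Phi>]) auto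
      ultimately show ?thesis
        by (simp add: step_sum_def)
    qed
    then show ?thesis by blast
  qed
  then have "continuous_map (subtopology full_shift X) (discrete_topology UNIV) ?u"
    by (simp add: continuous_map_discrete_iff)
  moreover have "continuous_map (subtopology full_shift X) (subtopology full_shift Z) (\<Psi> \<circ> \<Phi>)"
    using c by (rule continuous_map_compose)
  moreover have "(\<Psi> \<circ> \<Phi>) (shift x) = (shift ^^ ?u x) ((\<Psi> \<circ> \<Phi>) x)" if "x \<in> X" for x
    using dill_cocycle_shift[OF \<Phi> that, of 1]
      dill_cocycle_shift[OF \<Psi> dill_cocycle_mem[OF \<Phi> that], of "s x"] by simp
  \<comment> \<open>Some partial sum of the composed cocycle is positive, hence so is one of its
    terms.\<close>
  moreover have "\<exists>n. ?u ((shift ^^ n) x) > 0" if x: "x \<in> X" for x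
  proof -
    obtain m where m: "0 < step_sum t m (\<Phi> x)"
      using step_sum_unbounded[OF \<Psi> dill_cocycle_mem[OF \<Phi> x]] by blast
    obtain n where "m < step_sum s n x"
      using step_sum_unbounded[OF \<Phi> x] by blast
    then have "0 < step_sum t (step_sum s n x) (\<Phi> x)"
      using m step_sum_mono[of m "step_sum s n x" t "\<Phi> x"] by simp
    then have "step_sum ?u n x \<noteq> 0"
      by (simp add: step_sum_compose[OF \<Phi> x])
    then obtain i where "?u ((shift ^^ i) x) \<noteq> 0"
      unfolding step_sum_def[of ?u] by (rule sum.not_neutral_contains_not_neutral)
    then show ?thesis
      by blast
  qed
  ultimately show ?thesis
    using X Z by (simp add: dill_cocycle_def)
qed

section \<open>Implementations and their invariants\<close>

text \<open>By the cocycle equation the word read at each shift starts where the previous one ended,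
  so the words concatenate to \<open>\<Phi> x\<close>; the total length is infinite because the
  partial sums are unbounded.\<close>

lemma implements_dill_cocycle:
  fixes X :: "(nat \<Rightarrow> 'a::finite) set"
  assumes \<Phi>: "dill_cocycle X Y \<Phi> s"
  shows "implements X \<Phi> (restrict (\<lambda>x. map (\<Phi> x) [0..<s x]) X)"
proof -
  let ?\<phi> = "restrict (\<lambda>x. map (\<Phi> x) [0..<s x]) X"
  have X: "subshift X" using \<Phi> by (simp add: dill_cocycle_def)
  obtain C where C: "step_radius X \<Phi> s C"
    using step_radius_exists[OF \<Phi>] by blast
  have "?\<phi> x = ?\<phi> y" if xy: "x \<in> X" "y \<in> X" "agree (Suc C) x y" for x y
  proof -
    have "s x = s y" "agree (s x) (\<Phi> x) (\<Phi> y)"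
      using C xy unfolding step_radius_def by blast+
    then show ?thesis using xy by (simp add: agree_def)
  qed
  then have cont: "continuous_map (subtopology full_shift X) (discrete_topology UNIV) ?\<phi>"
    unfolding continuous_map_discrete_iff by blast
  have "infinite_length (\<lambda>n. ?\<phi> ((shift ^^ n) x)) \<and> \<Phi> x = inf_concat (\<lambda>n. ?\<phi> ((shift ^^ n) x))"
    if x: "x \<in> X" for x
  proof -
    let ?w = "\<lambda>i. ?\<phi> ((shift ^^ i) x)"
    have "?w = (\<lambda>i. map (\<Phi> ((shift ^^ i) x)) [0..<s ((shift ^^ i) x)])"
      using subshift_shift[OF X x] by (intro ext restrict_apply')
    then have w: "blocks ?w n = map (\<Phi> x) [0..<step_sum s n x]" for n
      using blocks_dill_cocycle[OF \<Phi> x] by simp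
    have inf: "infinite_length ?w"
      unfolding infinite_length_def blocks_def[symmetric] w
      using step_sum_unbounded[OF \<Phi> x] by simp
    moreover have "inf_concat ?w = \<Phi> x"
      by (rule inf_concat_eqI[OF inf]) (simp only: w length_map length_upt diff_zero)
    ultimately show ?thesis by simp
  qed
  with cont show ?thesis
    unfolding implements_def by blast
qed

text \<open>Absence of periodic points is what makes the length of an implementing block, hence the
  block itself, determined by the map.\<close>

lemma implements_unique:
  assumes \<Phi>: "dill_cocycle X Y \<Phi> s" and Y: "aperiodic_shift Y"
    and \<phi>: "implements X \<Phi> \<phi>" and x: "x \<in> X"
  shows "\<phi> x = map (\<Phi> x) [0..<s x]"
proof -
  have sub: "subshift X" "subshift Y" using \<Phi> by (simp_all add: dill_cocycle_def)
  let ?w = "\<lambda>i. \<phi> ((shift ^^ i) x)"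
  have w: "infinite_length ?w" "\<Phi> x = inf_concat ?w"
    using \<phi> x by (auto simp: implements_def)
  have "\<Phi> (shift x) = inf_concat (\<lambda>i. \<phi> ((shift ^^ i) (shift x)))"
    using \<phi> subshift_shift[OF sub(1) x, of 1] by (auto simp: implements_def)
  also have "\<dots> = inf_concat (\<lambda>i. ?w (Suc i))"
    by (simp add: funpow_Suc_right del: funpow.simps)
  also have "\<dots> = (shift ^^ length (\<phi> x)) (\<Phi> x)"
    using shift_inf_concat[OF w(1)] w(2) by simp
  finally have "(shift ^^ s x) (\<Phi> x) = (shift ^^ length (\<phi> x)) (\<Phi> x)"
    using dill_cocycle_shift[OF \<Phi> x, of 1] by simp
  then have "s x = length (\<phi> x)"
    by (rule aperiodic_shift_inj[OF sub(2) Y dill_cocycle_mem[OF \<Phi> x]])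
  moreover have "map (\<Phi> x) [0..<length (\<phi> x)] = \<phi> x"
    using map_inf_concat[of ?w 1] w(2) by simp
  ultimately show ?thesis by simp
qed

text \<open>The values on \<open>X\<close> are forced by \<open>implements_unique\<close>, and
  extensionality fixes the rest, so the definite description picks exactly this function.\<close>

lemma implementation_eq:
  fixes X :: "(nat \<Rightarrow> 'a::finite) set"
  assumes \<Phi>: "dill_cocycle X Y \<Phi> s" and Y: "aperiodic_shift Y" and x: "x \<in> X"
  shows "implementation X \<Phi> x = map (\<Phi> x) [0..<s x]"
proof -
  let ?\<phi> = "restrict (\<lambda>x. map (\<Phi> x) [0..<s x]) X"
  have "implementation X \<Phi> = ?\<phi>"
    unfolding implementation_def
  proof (rule the_equality)
    show "?\<phi> \<in> extensional X \<and> implements X \<Phi> ?\<phi>"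
      using implements_dill_cocycle[OF \<Phi>] by simp
    show "\<phi> = ?\<phi>" if "\<phi> \<in> extensional X \<and> implements X \<Phi> \<phi>" for \<phi>
      using that implements_unique[OF \<Phi> Y] by (auto intro: extensionalityI[of _ X])
  qed
  then show ?thesis using x by simp
qed

lemma length_impl_iter:
  fixes X :: "(nat \<Rightarrow> 'a::finite) set"
  assumes \<Phi>: "dill_cocycle X Y \<Phi> s" and Y: "aperiodic_shift Y" and x: "x \<in> X"
  shows "length (impl_iter (implementation X \<Phi>) n x) = step_sum s n x"
proof -
  have X: "subshift X" using \<Phi> by (simp add: dill_cocycle_def)
  have "impl_iter (implementation X \<Phi>) n x =
      blocks (\<lambda>i. map (\<Phi> ((shift ^^ i) x)) [0..<s ((shift ^^ i) x)]) n"
    by (simp add: impl_iter_def blocks_def implementation_eq[OF \<Phi> Y subshift_shift[OF X x]])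
  then show ?thesis
    by (simp add: blocks_dill_cocycle[OF \<Phi> x])
qed

lemma impl_radius_le:
  fixes X :: "(nat \<Rightarrow> 'a::finite) set"
  assumes \<Phi>: "dill_cocycle X Y \<Phi> s" and Y: "aperiodic_shift Y" and C: "step_radius X \<Phi> s C"
  shows "impl_radius X \<Phi> \<le> C"
  unfolding impl_radius_def
proof (rule Least_le, intro ballI impI)
  fix x y assume xy: "x \<in> X" "y \<in> X" "\<forall>i\<le>C. x i = y i"
  then have "agree (Suc C) x y" by (simp add: agree_def less_Suc_eq_le)
  then have "s x = s y" "agree (s x) (\<Phi> x) (\<Phi> y)"
    using C xy(1,2) unfolding step_radius_def by blast+
  then show "implementation X \<Phi> x = implementation X \<Phi> y"
    unfolding implementation_eq[OF \<Phi> Y xy(1)] implementation_eq[OF \<Phi> Y xy(2)]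
    by (simp add: agree_def)
qed

text \<open>One step of \<open>\<Psi> \<circ> \<Phi>\<close> needs \<open>s x + B\<close> letters of
  \<open>\<Phi> x\<close>: one step of \<open>\<Phi>\<close> supplies \<open>s x\<close> of them,
  and \<open>K\<close> further steps supply the other \<open>B\<close>. These \<open>Suc K\<close>
  steps read \<open>Suc K + C\<close> letters of \<open>x\<close>.\<close>

lemma step_radius_compose:
  assumes \<Phi>: "dill_cocycle X Y \<Phi> s" and \<Psi>: "dill_cocycle Y Z \<Psi> t"
    and C: "step_radius X \<Phi> s C" and B: "step_radius Y \<Psi> t B"
    and K: "\<And>x. x \<in> X \<Longrightarrow> B \<le> step_sum s K x"
  shows "step_radius X (\<Psi> \<circ> \<Phi>) (\<lambda>x. step_sum t (s x) (\<Phi> x)) (C + K)"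
  unfolding step_radius_def
proof (intro ballI impI)
  fix x y assume x: "x \<in> X" and y: "y \<in> X" and "agree (Suc (C + K)) x y"
  then have a: "agree (Suc K + C) x y" "agree (Suc C) x y"
    by (auto intro: agree_mono simp: add.commute)
  have X: "subshift X" using \<Phi> by (simp add: dill_cocycle_def)
  have s: "s x = s y"
    using C a(2) x y unfolding step_radius_def by blast
  have "s x + B \<le> step_sum s (1 + K) x"
    unfolding step_sum_add using K[OF subshift_shift[OF X x, of 1]] by simp
  moreover have "agree (step_sum s (Suc K) x) (\<Phi> x) (\<Phi> y)"
    using step_radius_lag[OF \<Phi> C x y a(1)] by blast
  ultimately have "agree (s x + B) (\<Phi> x) (\<Phi> y)"
    by (auto intro: agree_mono)
  then have "step_sum t (s x) (\<Phi> x) = step_sum t (s x) (\<Phi> y) \<and>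
      agree (step_sum t (s x) (\<Phi> x)) (\<Psi> (\<Phi> x)) (\<Psi> (\<Phi> y))"
    by (intro step_radius_lag[OF \<Psi> B] dill_cocycle_mem[OF \<Phi>] x y)
  then show "step_sum t (s x) (\<Phi> x) = step_sum t (s y) (\<Phi> y) \<and>
      agree (step_sum t (s x) (\<Phi> x)) ((\<Psi> \<circ> \<Phi>) x) ((\<Psi> \<circ> \<Phi>) y)"
    unfolding s[symmetric] o_apply .
qed

text \<open>Balanced growth expressed through the cocycle. The bound is real, so that rounding can
  wait until the final discrepancy bound.\<close>

definition step_balanced :: "(nat \<Rightarrow> 'a) set \<Rightarrow> ((nat \<Rightarrow> 'a) \<Rightarrow> nat) \<Rightarrow> real \<Rightarrow> real \<Rightarrow> bool" where
  "step_balanced X s g D \<longleftrightarrow> (\<forall>x\<in>X. \<forall>n. \<bar>real (step_sum s n x) - g * real n\<bar> \<le> D)"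

lemma step_balancedD:
  "step_balanced X s g D \<Longrightarrow> x \<in> X \<Longrightarrow> \<bar>real (step_sum s n x) - g * real n\<bar> \<le> D"
  by (simp add: step_balanced_def)

lemma step_balanced_mono: "step_balanced X s g D \<Longrightarrow> D \<le> E \<Longrightarrow> step_balanced X s g E"
  unfolding step_balanced_def by (meson order_trans)

text \<open>The error of \<open>t\<close> at the inner time \<open>m = step_sum s n x\<close> adds
  to the error of \<open>m\<close> itself, scaled by the rate of \<open>t\<close>.\<close>

lemma step_balanced_compose:
  assumes \<Phi>: "dill_cocycle X Y \<Phi> s" and s: "step_balanced X s g D" and t: "step_balanced Y t h E"
  shows "step_balanced X (\<lambda>x. step_sum t (s x) (\<Phi> x)) (h * g) (E + \<bar>h\<bar> * D)"
  unfolding step_balanced_def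
proof (intro ballI allI)
  fix x n assume x: "x \<in> X"
  define m where "m = step_sum s n x"
  have "\<bar>real (step_sum t m (\<Phi> x)) - h * real m\<bar> \<le> E"
    by (rule step_balancedD[OF t dill_cocycle_mem[OF \<Phi> x]])
  moreover have "\<bar>h * real m - h * g * real n\<bar> \<le> \<bar>h\<bar> * D"
    using mult_left_mono[OF step_balancedD[OF s x, of n], of "\<bar>h\<bar>"]
    by (simp add: m_def abs_mult[symmetric] right_diff_distrib mult.assoc)
  ultimately have "\<bar>real (step_sum t m (\<Phi> x)) - h * g * real n\<bar> \<le> E + \<bar>h\<bar> * D"
    by linarith
  then show "\<bar>real (step_sum (\<lambda>x. step_sum t (s x) (\<Phi> x)) n x) - h * g * real n\<bar> \<le> E + \<bar>h\<bar> * D"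
    by (simp add: step_sum_compose[OF \<Phi> x] m_def)
qed

text \<open>\<open>K\<close> is chosen with \<open>g * K - D \<ge> B\<close>, so balance forces
  \<open>K\<close> steps of \<open>\<Phi>\<close> to produce at least \<open>B\<close>
  letters.\<close>

lemma step_radius_compose_balanced:
  assumes \<Phi>: "dill_cocycle X Y \<Phi> s" and \<Psi>: "dill_cocycle Y Z \<Psi> t"
    and C: "step_radius X \<Phi> s C" and B: "step_radius Y \<Psi> t B"
    and s: "step_balanced X s g D" and g: "g > 0"
  shows "step_radius X (\<Psi> \<circ> \<Phi>) (\<lambda>x. step_sum t (s x) (\<Phi> x)) (C + nat \<lceil>(real B + D) / g\<rceil>)"
proof (rule step_radius_compose[OF \<Phi> \<Psi> C B])
  fix x assume x: "x \<in> X"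
  let ?K = "nat \<lceil>(real B + D) / g\<rceil>"
  have "(real B + D) / g \<le> real ?K" by (rule real_nat_ceiling_ge)
  then have "real B + D \<le> g * real ?K"
    using g by (simp add: field_simps)
  then have "real B \<le> real (step_sum s ?K x)"
    using step_balancedD[OF s x, of ?K] by linarith
  then show "B \<le> step_sum s ?K x" by simp
qed

lemma step_balanced_has_growth_rate:
  fixes X :: "(nat \<Rightarrow> 'a::finite) set"
  assumes \<Phi>: "dill_cocycle X Y \<Phi> s" and Y: "aperiodic_shift Y" and s: "step_balanced X s g D"
  shows "has_growth_rate X \<Phi> g"
  unfolding has_growth_rate_def
proof
  fix x assume x: "x \<in> X"
  have "(\<lambda>n. real (step_sum s n x) / real n - g) \<longlonglongrightarrow> 0"
  proof (rule Lim_null_comparison)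
    show "\<forall>\<^sub>F n in sequentially. norm (real (step_sum s n x) / real n - g) \<le> D / real n"
      using eventually_gt_at_top[of 0]
    proof eventually_elim
      case (elim n)
      then have "real (step_sum s n x) / real n - g = (real (step_sum s n x) - g * real n) / real n"
        by (simp add: field_simps)
      then show ?case
        using step_balancedD[OF s x, of n] elim by (simp add: divide_right_mono)
    qed
    show "(\<lambda>n. D / real n) \<longlonglongrightarrow> 0" by (rule lim_const_over_n)
  qed
  then have "(\<lambda>n. real (step_sum s n x) / real n) \<longlonglongrightarrow> g"
    using LIM_zero_iff by blast
  then show "(\<lambda>n. real (length (impl_iter (implementation X \<Phi>) n x)) / real n) \<longlonglongrightarrow> g"
    by (simp add: length_impl_iter[OF \<Phi> Y x])
qed

text \<open>Uniqueness of the growth rate is uniqueness of a limit at some point of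
  \<open>X\<close>, whence the nonemptiness.\<close>

lemma step_balanced_growth:
  fixes X :: "(nat \<Rightarrow> 'a::finite) set"
  assumes \<Phi>: "dill_cocycle X Y \<Phi> s" and Y: "aperiodic_shift Y" and X: "X \<noteq> {}"
    and s: "step_balanced X s g (real D)"
  shows "balanced_growth X \<Phi> \<and> growth_rate X \<Phi> = g \<and> discrepancy X \<Phi> \<le> D"
proof -
  obtain x where x: "x \<in> X" using X by blast
  note g = step_balanced_has_growth_rate[OF \<Phi> Y s]
  have uniq: "l = g" if "has_growth_rate X \<Phi> l" for l
    using LIMSEQ_unique that g x unfolding has_growth_rate_def by blast
  have gr: "growth_rate X \<Phi> = g"
    unfolding growth_rate_def using g uniq by (rule the_equality)
  have "discrepancy_bound X \<Phi> D"
    unfolding discrepancy_bound_def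
  proof (intro ballI allI)
    fix x n assume "x \<in> X"
    then show "real (length (impl_iter (implementation X \<Phi>) n x))
        \<in> {growth_rate X \<Phi> * real n - real D..growth_rate X \<Phi> * real n + real D}"
      using step_balancedD[OF s, of x n] by (simp add: length_impl_iter[OF \<Phi> Y] gr abs_le_iff)
  qed
  then have "balanced_growth X \<Phi>" "discrepancy X \<Phi> \<le> D"
    using g uniq unfolding balanced_growth_def discrepancy_def by (blast, auto intro: Least_le)
  then show ?thesis using gr by blast
qed

text \<open>On the empty set every real is a growth rate, against uniqueness.\<close>

lemma balanced_growth_nonempty: "balanced_growth X \<Phi> \<Longrightarrow> X \<noteq> {}"
proof
  assume "balanced_growth X \<Phi>" and "X = {}"
  then have "\<exists>!l :: real. True" by (simp add: balanced_growth_def has_growth_rate_def)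
  then show False by (metis zero_neq_one)
qed

lemma balanced_growth_step_balanced:
  fixes X :: "(nat \<Rightarrow> 'a::finite) set"
  assumes \<Phi>: "dill_cocycle X Y \<Phi> s" and Y: "aperiodic_shift Y" and b: "balanced_growth X \<Phi>"
  shows "\<exists>D::nat. step_balanced X s (growth_rate X \<Phi>) (real D)"
proof -
  obtain D where D: "discrepancy_bound X \<Phi> D"
    using b by (auto simp: balanced_growth_def)
  have "step_balanced X s (growth_rate X \<Phi>) (real D)"
    unfolding step_balanced_def
  proof (intro ballI allI)
    fix x n assume x: "x \<in> X"
    then have "real (step_sum s n x) \<in> {growth_rate X \<Phi> * real n - real D..growth_rate X \<Phi> * real n + real D}"
      using D length_impl_iter[OF \<Phi> Y x, of n] unfolding discrepancy_bound_def by metis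
    then show "\<bar>real (step_sum s n x) - growth_rate X \<Phi> * real n\<bar> \<le> real D"
      by (simp add: abs_le_iff)
  qed
  then show ?thesis by blast
qed

section \<open>Substitution subshifts\<close>

lemma substitution_Nil: "substitution \<theta> \<Longrightarrow> \<theta> [] = []"
  unfolding substitution_def by (metis append_Nil append_self_conv)

lemma substitution_append: "substitution \<theta> \<Longrightarrow> \<theta> (u @ v) = \<theta> u @ \<theta> v"
  by (simp add: substitution_def)

lemma substitution_funpow: "substitution \<theta> \<Longrightarrow> substitution (\<theta> ^^ n)"
  by (induction n) (simp_all add: substitution_def)

lemma substitution_blocks:
  "substitution \<theta> \<Longrightarrow> \<theta> (map x [0..<n]) = blocks (\<lambda>i. \<theta> [x i]) n"
  by (induction n) (simp_all add: substitution_Nil substitution_append)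

lemma sublist_substitution: "substitution \<theta> \<Longrightarrow> sublist u v \<Longrightarrow> sublist (\<theta> u) (\<theta> v)"
  unfolding sublist_def by (metis substitution_append)

text \<open>A letter erased by some power stays erased under all higher ones, yet primitivity puts
  it into its own late images.\<close>

lemma primitive_nonerasing:
  assumes "substitution \<tau>" "primitive \<tau>"
  shows "(\<tau> ^^ n) [a] \<noteq> []"
proof
  assume n: "(\<tau> ^^ n) [a] = []"
  have "\<forall>\<^sub>F m in sequentially. sublist [a] ((\<tau> ^^ m) [a]) \<and> n \<le> m"
    using assms(2) eventually_ge_at_top[of n] by (auto simp: primitive_def intro: eventually_conj)
  then obtain m where m: "sublist [a] ((\<tau> ^^ m) [a])" "n \<le> m"
    using eventually_happens by fastforce
  have "(\<tau> ^^ m) [a] = (\<tau> ^^ (m - n + n)) [a]"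
    using m(2) by simp
  also have "\<dots> = (\<tau> ^^ (m - n)) ((\<tau> ^^ n) [a])"
    by (simp only: funpow_add o_apply)
  also have "\<dots> = []"
    using substitution_Nil[OF substitution_funpow[OF assms(1)]] n by simp
  finally show False using m(1) by simp
qed

lemma length_blocks_ge:
  assumes "\<And>i. w i \<noteq> []" shows "n \<le> length (blocks w n)"
proof (induction n)
  case (Suc n)
  then show ?case using assms[of n] by (cases "w n") auto
qed simp

lemma infinite_length_nonempty: "(\<And>i. w i \<noteq> []) \<Longrightarrow> infinite_length w"
  unfolding infinite_length_def blocks_def[symmetric] using length_blocks_ge Suc_le_eq by blast

lemma map_subst_act:
  assumes "substitution \<theta>"
  shows "map (subst_act \<theta> x) [0..<length (\<theta> (map x [0..<n]))] = \<theta> (map x [0..<n])"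
  unfolding subst_act_def substitution_blocks[OF assms] by (rule map_inf_concat)

lemma subst_act_nth:
  assumes "substitution \<theta>" "\<And>a. \<theta> [a] \<noteq> []"
  shows "subst_act \<theta> x k = \<theta> (map x [0..<Suc k]) ! k"
  unfolding subst_act_def substitution_blocks[OF assms(1)]
  by (rule inf_concat_nth) (use length_blocks_ge[of "\<lambda>i. \<theta> [x i]" "Suc k"] assms(2) in simp)

lemma subst_act_shift:
  assumes "substitution \<theta>" "\<And>a. \<theta> [a] \<noteq> []"
  shows "subst_act \<theta> (shift x) = (shift ^^ length (\<theta> [x 0])) (subst_act \<theta> x)"
  using shift_inf_concat[OF infinite_length_nonempty, of "\<lambda>i. \<theta> [x i]"] assms(2)
  by (simp add: subst_act_def shift_def)

lemma subshift_subst_shift: "subshift (subst_shift \<tau>)"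
proof -
  have "x \<in> subst_shift \<tau>" if x: "\<And>N. \<exists>y\<in>subst_shift \<tau>. agree N x y" for x
    unfolding subst_shift_def
  proof (intro CollectI allI)
    fix i j
    obtain y where y: "y \<in> subst_shift \<tau>" "agree j x y"
      using x by blast
    have "map x [i..<j] = map y [i..<j]"
      using y(2) by (simp add: agree_def)
    moreover have "\<exists>a n. sublist (map y [i..<j]) ((\<tau> ^^ n) [a])"
      using y(1) by (simp add: subst_shift_def)
    ultimately show "\<exists>a n. sublist (map x [i..<j]) ((\<tau> ^^ n) [a])"
      by (simp only:)
  qed
  moreover have "shift x \<in> subst_shift \<tau>" if "x \<in> subst_shift \<tau>" for x
    unfolding subst_shift_def
  proof (intro CollectI allI)
    fix i j
    have "map (shift x) [i..<j] = map x [Suc i..<Suc j]"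
      by (rule nth_equalityI) (simp_all add: shift_def del: upt_Suc)
    then show "\<exists>a n. sublist (map (shift x) [i..<j]) ((\<tau> ^^ n) [a])"
      using that by (simp add: subst_shift_def del: upt_Suc)
  qed
  ultimately show ?thesis
    unfolding subshift_def closedin_full_shift by blast
qed

lemma sublist_map_upt: "j \<le> n \<Longrightarrow> sublist (map x [i..<j]) (map x [0..<n])"
proof (cases "i \<le> j")
  case True
  assume "j \<le> n"
  then have "[0..<n] = [0..<i] @ [i..<j] @ [j..<n]"
    using True by (metis bot_nat_0.extremum le_trans upt_add_eq_append le_Suc_ex)
  then show ?thesis by (metis map_append sublist_appendI)
qed simp

text \<open>As no letter is erased, a factor of the image ending by position \<open>j\<close> lies
  in the image of the first \<open>j\<close> letters of \<open>x\<close>, which in turn is a factor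
  of a power of \<open>\<tau>\<close> applied to a letter.\<close>

lemma subst_act_mem:
  assumes \<tau>: "substitution \<tau>" "primitive \<tau>" and x: "x \<in> subst_shift \<tau>"
  shows "subst_act (\<tau> ^^ m) x \<in> subst_shift \<tau>"
  unfolding subst_shift_def
proof (intro CollectI allI)
  fix i j
  let ?\<theta> = "\<tau> ^^ m"
  note \<theta> = substitution_funpow[OF \<tau>(1), of m]
  obtain a n where "sublist (map x [0..<j]) ((\<tau> ^^ n) [a])"
    using x unfolding subst_shift_def by blast
  then have "sublist (?\<theta> (map x [0..<j])) ((\<tau> ^^ (m + n)) [a])"
    using sublist_substitution[OF \<theta>] by (simp add: funpow_add)
  moreover have "j \<le> length (?\<theta> (map x [0..<j]))"
    unfolding substitution_blocks[OF \<theta>] using primitive_nonerasing[OF \<tau>] by (intro length_blocks_ge)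
  then have "sublist (map (subst_act ?\<theta> x) [i..<j]) (?\<theta> (map x [0..<j]))"
    by (subst map_subst_act[OF \<theta>, of x j, symmetric]) (rule sublist_map_upt)
  ultimately show "\<exists>a n. sublist (map (subst_act ?\<theta> x) [i..<j]) ((\<tau> ^^ n) [a])"
    using sublist_order.order_trans by blast
qed

text \<open>Stated for all powers: exponent 1 gives the action of \<open>\<tau>\<close>, and a large
  exponent serves to prove recurrence.\<close>

lemma subst_act_dill_cocycle:
  fixes \<tau> :: "'a::finite list \<Rightarrow> 'a list"
  assumes \<tau>: "substitution \<tau>" "primitive \<tau>"
  shows "dill_cocycle (subst_shift \<tau>) (subst_shift \<tau>) (subst_act (\<tau> ^^ m)) (\<lambda>x. length ((\<tau> ^^ m) [x 0]))"
proof -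
  let ?X = "subst_shift \<tau>" and ?\<theta> = "\<tau> ^^ m"
  note \<theta> = substitution_funpow[OF \<tau>(1), of m] primitive_nonerasing[OF \<tau>, of m]
  have "continuous_map (subtopology full_shift ?X) (discrete_topology UNIV) (\<lambda>x. subst_act ?\<theta> x k)" for k
    unfolding continuous_map_discrete_iff
  proof (intro ballI exI impI)
    fix x y :: "nat \<Rightarrow> 'a" assume "agree (Suc k) x y"
    then have "map x [0..<Suc k] = map y [0..<Suc k]"
      by (simp add: agree_def del: upt_Suc)
    then show "subst_act ?\<theta> x k = subst_act ?\<theta> y k"
      unfolding subst_act_nth[OF \<theta>] by (simp only:)
  qed
  then have "continuous_map (subtopology full_shift ?X) (subtopology full_shift ?X) (subst_act ?\<theta>)"
    unfolding continuous_map_shift_spaces using subst_act_mem[OF \<tau>] by blast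
  moreover have "continuous_map (subtopology full_shift ?X) (discrete_topology UNIV) (\<lambda>x. length (?\<theta> [x 0]))"
    unfolding continuous_map_discrete_iff
    by (intro ballI exI[of _ 1]) (simp add: agree_def)
  ultimately show ?thesis
    unfolding dill_cocycle_def using subshift_subst_shift subst_act_shift[OF \<theta>] \<theta>(2) by auto
qed

text \<open>A consequence of minimality, weakened to a form that follows directly from primitivity:
  the returning point may be chosen after the cylinder.\<close>

definition recurrent :: "(nat \<Rightarrow> 'a) set \<Rightarrow> bool" where
  "recurrent X \<longleftrightarrow>
     (\<forall>z\<in>X. \<forall>N. \<exists>x\<in>X. agree N z x \<and> (\<forall>m. \<exists>n\<ge>m. agree N z ((shift ^^ n) x)))"

lemma recurrent_subst_shift:
  fixes \<tau> :: "'a::finite list \<Rightarrow> 'a list"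
  assumes \<tau>: "substitution \<tau>" "primitive \<tau>"
  shows "recurrent (subst_shift \<tau>)"
  unfolding recurrent_def
proof (intro ballI allI)
  fix z N assume z: "z \<in> subst_shift \<tau>"
  define w where "w = map z [0..<N]"
  obtain a n where an: "sublist w ((\<tau> ^^ n) [a])"
    using z unfolding subst_shift_def w_def by blast
  have "\<forall>\<^sub>F k in sequentially. \<forall>b. sublist [a] ((\<tau> ^^ k) [b])"
    using \<tau>(2) by (intro eventually_all_finite) (simp add: primitive_def)
  then obtain k where k: "\<And>b. sublist [a] ((\<tau> ^^ k) [b])"
    using eventually_happens by fastforce
  \<comment> \<open>After \<open>k\<close> steps every letter has produced \<open>a\<close>, and
    after \<open>n\<close> more steps \<open>a\<close> has produced \<open>w\<close>.\<close>
  define M where "M = n + k"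
  let ?\<theta> = "\<tau> ^^ M" and ?s = "\<lambda>x. length ((\<tau> ^^ M) [x 0])"
  note \<theta> = substitution_funpow[OF \<tau>(1), of M]
  have w: "sublist w (?\<theta> [b])" for b
    using sublist_substitution[OF substitution_funpow[OF \<tau>(1)] k[of b], of n] an
      sublist_order.order_trans by (auto simp: M_def funpow_add)
  define y where "y = subst_act ?\<theta> z"
  note \<Phi> = subst_act_dill_cocycle[OF \<tau>, of M]
  have y: "y \<in> subst_shift \<tau>"
    unfolding y_def by (rule dill_cocycle_mem[OF \<Phi> z])
  \<comment> \<open>The image of the letter \<open>z j\<close> contains \<open>w\<close>; this
    occurrence starts at position at least \<open>j\<close> in \<open>y\<close>, as all letter
    images are nonempty.\<close>
  have inf: "\<exists>i\<ge>j. agree N z ((shift ^^ i) y)" for j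
  proof -
    let ?z = "(shift ^^ j) z"
    obtain p q where pq: "?\<theta> [?z 0] = p @ w @ q"
      using w unfolding sublist_def by blast
    have m: "map (subst_act ?\<theta> ?z) [0..<length (p @ w @ q)] = p @ w @ q"
      using map_subst_act[OF \<theta>, of ?z 1] pq by simp
    have "subst_act ?\<theta> ?z (i + length p) = z i" if "i < N" for i
    proof -
      have "i + length p < length (p @ w @ q)"
        using that by (simp add: w_def)
      then have "subst_act ?\<theta> ?z (i + length p) = (p @ w @ q) ! (i + length p)"
        by (subst m[symmetric]) simp
      then show ?thesis
        using that by (simp add: w_def nth_append)
    qed
    then have "agree N z ((shift ^^ length p) (subst_act ?\<theta> ?z))"
      by (simp add: agree_def shift_funpow[of "length p"])
    then have "agree N z ((shift ^^ (length p + step_sum ?s j z)) y)"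
      by (simp only: dill_cocycle_shift[OF \<Phi> z] shift_shift y_def)
    moreover have "(\<Sum>i<j. 1) \<le> step_sum ?s j z"
      unfolding step_sum_def using primitive_nonerasing[OF \<tau>]
      by (intro sum_mono) (simp add: Suc_le_eq)
    ultimately show ?thesis
      by (intro exI[of _ "length p + step_sum ?s j z"]) simp
  qed
  \<comment> \<open>\<open>y\<close> itself may not begin with \<open>w\<close>; a shift of it that
    does is the desired point.\<close>
  obtain i where i: "agree N z ((shift ^^ i) y)"
    using inf by blast
  have "\<exists>n\<ge>m. agree N z ((shift ^^ n) ((shift ^^ i) y))" for m
  proof -
    obtain n where "n \<ge> m + i" "agree N z ((shift ^^ n) y)"
      using inf by blast
    then show ?thesis
      by (intro exI[of _ "n - i"]) (simp add: shift_shift)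
  qed
  then show "\<exists>x\<in>subst_shift \<tau>. agree N z x \<and> (\<forall>m. \<exists>n\<ge>m. agree N z ((shift ^^ n) x))"
    using i subshift_shift[OF subshift_subst_shift y] by blast
qed

section \<open>The growth rate of an almost inverse\<close>

text \<open>By Baire's theorem the shifts \<open>i\<close>, \<open>j\<close> aligning \<open>R x\<close> with \<open>x\<close> can be chosen
  constant on some cylinder. Along an orbit returning to it infinitely often, aperiodicity forces
  \<open>step_sum s n x = n\<close> at every return time \<open>n\<close>.\<close>

lemma almost_identity_rate:
  fixes X :: "(nat \<Rightarrow> 'a::finite) set"
  assumes R: "dill_cocycle X X R s" and X: "aperiodic_shift X" "recurrent X" "X \<noteq> {}"
    and ae: "almost_equal X R id" and s: "step_balanced X s g D"
  shows "g = 1"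
proof -
  have sub: "subshift X" using R by (simp add: dill_cocycle_def)
  let ?T = "subtopology full_shift X"
  define A where "A = (\<lambda>(i, j). {x \<in> X. (shift ^^ i) (R x) = (shift ^^ j) x})"
  have top: "topspace ?T = X" by simp
  have contR: "continuous_map ?T full_shift R"
    using R by (simp add: dill_cocycle_def continuous_map_in_subtopology)
  have closed: "closedin ?T (A (i, j))" for i j
  proof -
    have "continuous_map ?T full_shift ((shift ^^ i) \<circ> R)"
      by (rule continuous_map_compose[OF contR continuous_map_shift_funpow])
    moreover have "continuous_map ?T full_shift (shift ^^ j)"
      by (rule continuous_map_from_subtopology[OF continuous_map_shift_funpow])
    ultimately have "closedin ?T {x \<in> topspace ?T. ((shift ^^ i) \<circ> R) x = (shift ^^ j) x}"
      by (rule closedin_continuous_maps_eq[OF Hausdorff_full_shift])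
    then show ?thesis by (simp add: A_def)
  qed
  have un: "\<Union>(range A) = X"
    using ae by (force simp: almost_equal_def A_def)
  have comp: "compact_space ?T"
    by (rule compact_space_subtopology[OF compactin_subshift[OF sub]])
  have Haus: "Hausdorff_space ?T"
    by (rule Hausdorff_space_subtopology[OF Hausdorff_full_shift])
  have lc: "locally_compact_space ?T \<and> regular_space ?T"
    using comp Haus compact_imp_locally_compact_space compact_Hausdorff_imp_regular_space by blast
  have "\<exists>i j. ?T interior_of (A (i, j)) \<noteq> {}"
  proof (rule ccontr)
    assume "\<not> ?thesis"
    then have "closedin ?T B \<and> ?T interior_of B = {}" if "B \<in> range A" for B
      using that closed by auto
    then have "?T interior_of \<Union>(range A) = {}"
      using lc by (intro Baire_category_alt) auto
    then show False
      using X(3) unfolding un by (metis interior_of_topspace top)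
  qed
  then obtain i j z where "z \<in> ?T interior_of (A (i, j))" by blast
  then obtain U where U: "openin ?T U" "z \<in> U" "U \<subseteq> A (i, j)"
    unfolding interior_of_def by blast
  then obtain V where V: "openin full_shift V" "U = V \<inter> X"
    unfolding openin_subtopology by blast
  obtain N where N: "\<And>y. agree N z y \<Longrightarrow> y \<in> V"
    using V U(2) unfolding openin_full_shift by blast
  have A: "(shift ^^ i) (R y) = (shift ^^ j) y" if "y \<in> X" "agree N z y" for y
    using N[OF that(2)] that(1) U(3) V(2) by (auto simp: A_def)
  have "z \<in> X" using U(2) V(2) by blast
  then obtain x where x: "x \<in> X" "agree N z x" "\<And>m. \<exists>n\<ge>m. agree N z ((shift ^^ n) x)"
    using X(2) unfolding recurrent_def by blast
  \<comment> \<open>\<open>x\<close> and its return \<open>(shift ^^ n) x\<close> lie in the same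
    cylinder and are aligned by the same \<open>i\<close> and \<open>j\<close>; comparing the two
    alignments leaves \<open>j + n\<close> against \<open>step_sum s n x + j\<close>.\<close>
  have "\<exists>n\<ge>m. step_sum s n x = n" for m
  proof -
    obtain n where n: "n \<ge> m" "agree N z ((shift ^^ n) x)"
      using x(3) by blast
    have "(shift ^^ (j + n)) x = (shift ^^ j) ((shift ^^ n) x)"
      by (simp add: shift_shift)
    also have "\<dots> = (shift ^^ i) (R ((shift ^^ n) x))"
      using A[OF subshift_shift[OF sub x(1)] n(2)] by simp
    also have "\<dots> = (shift ^^ (i + step_sum s n x)) (R x)"
      by (simp only: dill_cocycle_shift[OF R x(1)] shift_shift)
    also have "\<dots> = (shift ^^ (step_sum s n x + i)) (R x)"
      by (simp only: add.commute)
    also have "\<dots> = (shift ^^ (step_sum s n x)) ((shift ^^ i) (R x))"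
      by (simp only: shift_shift)
    also have "\<dots> = (shift ^^ (step_sum s n x + j)) x"
      by (simp only: A[OF x(1,2)] shift_shift)
    finally have "j + n = step_sum s n x + j"
      by (rule aperiodic_shift_inj[OF sub X(1) x(1)])
    then show ?thesis using n(1) by auto
  qed
  \<comment> \<open>At these times the balance estimate bounds the distance of \<open>g * n\<close>
    from \<open>n\<close> by \<open>D\<close>; arbitrarily large \<open>n\<close> leave only
    \<open>g = 1\<close>.\<close>
  then have *: "\<exists>n\<ge>m. \<bar>1 - g\<bar> * real n \<le> D" for m
    using step_balancedD[OF s x(1)] by (metis abs_mult abs_of_nat left_diff_distrib mult_1)
  show "g = 1"
  proof (rule ccontr)
    assume "g \<noteq> 1"
    then have pos: "\<bar>1 - g\<bar> > 0" by simp
    obtain m :: nat where "D / \<bar>1 - g\<bar> < real m"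
      using reals_Archimedean2 by blast
    then have "D < \<bar>1 - g\<bar> * real m"
      using pos by (simp add: field_simps)
    moreover obtain n where "n \<ge> m" "\<bar>1 - g\<bar> * real n \<le> D"
      using * by blast
    moreover have "\<bar>1 - g\<bar> * real m \<le> \<bar>1 - g\<bar> * real n"
      using \<open>n \<ge> m\<close> by (intro mult_left_mono) auto
    ultimately show False by linarith
  qed
qed

section \<open>Iterates\<close>

lemma step_balanced_one: "step_balanced X (\<lambda>_. 1) 1 0"
  by (simp add: step_balanced_def step_sum_def)

lemma block_map_dill_cocycle: "block_map X Y f \<Longrightarrow> dill_cocycle X Y f (\<lambda>_. 1)"
  by (simp add: block_map_def dill_cocycle_def)

text \<open>Each recursion step splits off the innermost \<open>\<Phi>\<close>, which matches
  \<open>funpow_Suc_right\<close> and the composition lemmas; the identity has cocycle 1.\<close>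

primrec funpow_step ::
    "((nat \<Rightarrow> 'a) \<Rightarrow> nat \<Rightarrow> 'a) \<Rightarrow> ((nat \<Rightarrow> 'a) \<Rightarrow> nat) \<Rightarrow> nat \<Rightarrow> (nat \<Rightarrow> 'a) \<Rightarrow> nat" where
  "funpow_step \<Phi> s 0 = (\<lambda>_. 1)"
| "funpow_step \<Phi> s (Suc k) = (\<lambda>x. step_sum (funpow_step \<Phi> s k) (s x) (\<Phi> x))"

lemma funpow_dill_cocycle:
  fixes X :: "(nat \<Rightarrow> 'a::finite) set"
  assumes "dill_cocycle X X \<Phi> s"
  shows "dill_cocycle X X (\<Phi> ^^ k) (funpow_step \<Phi> s k)"
proof (induction k)
  case 0
  have "block_map X X id"
    using assms by (auto simp: block_map_def dill_cocycle_def)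
  then show ?case using block_map_dill_cocycle by (simp add: id_def)
next
  case (Suc k)
  then show ?case
    unfolding funpow_Suc_right funpow_step.simps by (rule dill_cocycle_compose[OF assms])
qed

text \<open>Iterating the composition bound adds \<open>g ^ k * D\<close> at each step; the sum
  stays bounded for \<open>g < 1\<close> and is of order \<open>g ^ k\<close> for
  \<open>g > 1\<close>.\<close>

lemma funpow_step_balanced:
  fixes X :: "(nat \<Rightarrow> 'a::finite) set"
  assumes \<Phi>: "dill_cocycle X X \<Phi> s" and s: "step_balanced X s g D" and g: "g \<ge> 0"
  shows "step_balanced X (funpow_step \<Phi> s k) (g ^ k) (D * (\<Sum>i<k. g ^ i))"
proof (induction k)
  case 0
  then show ?case using step_balanced_one by simp
next
  case (Suc k)
  have "step_balanced X (funpow_step \<Phi> s (Suc k)) (g ^ k * g) (D * (\<Sum>i<k. g ^ i) + \<bar>g ^ k\<bar> * D)"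
    unfolding funpow_step.simps by (rule step_balanced_compose[OF \<Phi> s Suc])
  then show ?case
    using g by (simp add: algebra_simps)
qed

lemma step_radius_id: "step_radius X id (\<lambda>_. 1) 0"
  by (simp add: step_radius_def)

text \<open>An outer radius 0 calls for no letters beyond the current step, so \<open>K = 0\<close>
  works in the composition bound.\<close>

lemma funpow_step_radius_0:
  fixes X :: "(nat \<Rightarrow> 'a::finite) set"
  assumes \<Phi>: "dill_cocycle X X \<Phi> s" and s: "step_radius X \<Phi> s 0"
  shows "step_radius X (\<Phi> ^^ k) (funpow_step \<Phi> s k) 0"
proof (induction k)
  case 0
  then show ?case using step_radius_id by (simp add: id_def)
next
  case (Suc k)
  have "step_radius X (\<Phi> ^^ k \<circ> \<Phi>) (\<lambda>x. step_sum (funpow_step \<Phi> s k) (s x) (\<Phi> x)) (0 + 0)"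
    by (rule step_radius_compose[OF \<Phi> funpow_dill_cocycle[OF \<Phi>] s Suc]) simp
  then show ?case
    unfolding funpow_Suc_right funpow_step.simps by (simp only: add_0)
qed

text \<open>Composition at rate \<open>1 / l\<close> turns a radius \<open>B\<close> into at most
  \<open>C + 1 + l * D + l * B\<close>, the 1 coming from the ceiling; iteration gives the geometric
  sum.\<close>

lemma funpow_step_radius:
  fixes X :: "(nat \<Rightarrow> 'a::finite) set"
  assumes \<Phi>: "dill_cocycle X X \<Phi> s" and C: "step_radius X \<Phi> s C"
    and s: "step_balanced X s (1 / l) D" and l: "l > 0" and D: "D \<ge> 0"
  shows "\<exists>B. step_radius X (\<Phi> ^^ k) (funpow_step \<Phi> s k) B \<and>
    real B \<le> (real C + 1 + l * D) * (\<Sum>i<k. l ^ i)"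
proof (induction k)
  case 0
  then show ?case using step_radius_id by (intro exI[of _ 0]) (simp add: id_def)
next
  case (Suc k)
  define K where "K = real C + 1 + l * D"
  obtain B where B: "step_radius X (\<Phi> ^^ k) (funpow_step \<Phi> s k) B" "real B \<le> K * (\<Sum>i<k. l ^ i)"
    using Suc unfolding K_def by blast
  have g: "1 / l > 0" using l by simp
  let ?B = "C + nat \<lceil>(real B + D) / (1 / l)\<rceil>"
  have "step_radius X (\<Phi> ^^ Suc k) (funpow_step \<Phi> s (Suc k)) ?B"
    unfolding funpow_Suc_right funpow_step.simps
    by (rule step_radius_compose_balanced[OF \<Phi> funpow_dill_cocycle[OF \<Phi>] C B(1) s g])
  moreover have "real ?B \<le> K * (\<Sum>i<Suc k. l ^ i)"
  proof -
    have "0 \<le> (real B + D) / (1 / l)" using l D by simp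
    then have "real ?B \<le> real C + ((real B + D) / (1 / l) + 1)"
      by linarith
    also have "\<dots> = K + l * real B"
      by (simp add: K_def algebra_simps)
    also have "\<dots> \<le> K + l * (K * (\<Sum>i<k. l ^ i))"
      using B(2) l by simp
    also have "\<dots> = K * (\<Sum>i<Suc k. l ^ i)"
      unfolding sum.lessThan_Suc_shift by (simp add: sum_distrib_left algebra_simps)
    finally show ?thesis .
  qed
  ultimately show ?case unfolding K_def by blast
qed

text \<open>The first block of the image is the image of the first letter, so letter 0 decides both
  its length and its content.\<close>

lemma subst_act_step_radius:
  fixes \<theta> :: "'a list \<Rightarrow> 'a list"
  assumes "substitution \<theta>"
  shows "step_radius X (subst_act \<theta>) (\<lambda>x. length (\<theta> [x 0])) 0"
  unfolding step_radius_def
proof (intro ballI impI)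
  fix x y :: "nat \<Rightarrow> 'a" assume "agree (Suc 0) x y"
  then have 0: "x 0 = y 0" by (simp add: agree_def)
  have *: "map (subst_act \<theta> z) [0..<length (\<theta> [z 0])] = \<theta> [z 0]" for z
    using map_subst_act[OF assms, of z 1] by simp
  have "map (subst_act \<theta> x) [0..<length (\<theta> [x 0])] = map (subst_act \<theta> y) [0..<length (\<theta> [x 0])]"
    using *[of x] *[of y] 0 by simp
  then show "length (\<theta> [x 0]) = length (\<theta> [y 0]) \<and>
      agree (length (\<theta> [x 0])) (subst_act \<theta> x) (subst_act \<theta> y)"
    using 0 by (simp add: agree_def)
qed

text \<open>Makes the bounds of order \<open>l ^ k\<close>, for the discrepancy of powers of
  \<open>\<tau>\<close> and the radii of powers of the almost inverse, uniform after division by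
  \<open>l ^ k\<close>.\<close>

lemma geometric_sum_le:
  fixes l :: real
  assumes "l > 1"
  shows "(\<Sum>i<k. l ^ i) / l ^ k \<le> 1 / (l - 1)"
proof -
  have "(\<Sum>i<k. l ^ i) = (l ^ k - 1) / (l - 1)"
    using geometric_sum[of l k] assms by simp
  also have "\<dots> \<le> l ^ k / (l - 1)"
    using assms by (intro divide_right_mono) auto
  finally show ?thesis
    using assms by (simp add: field_simps)
qed

text \<open>Bounds the discrepancy of all powers of the almost inverse at once.\<close>

lemma geometric_sum_inverse_le:
  fixes l :: real
  assumes "l > 1"
  shows "(\<Sum>i<k. (1 / l) ^ i) \<le> l / (l - 1)"
proof -
  have "(\<Sum>i<k. (1 / l) ^ i) = (1 - (1 / l) ^ k) / (1 - 1 / l)"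
    using geometric_sum[of "1 / l" k] assms by (simp add: field_simps)
  also have "\<dots> \<le> 1 / (1 - 1 / l)"
    using assms by (intro divide_right_mono) auto
  finally show ?thesis
    using assms by (simp add: field_simps)
qed

theorem lemma19:
  fixes \<tau> :: "'a::finite list \<Rightarrow> 'a list"
    and \<rho> :: "'b::finite list \<Rightarrow> 'b list"
    and \<rho>inv :: "(nat \<Rightarrow> 'b) \<Rightarrow> nat \<Rightarrow> 'b"
    and l :: real
  assumes "substitution \<tau>" and "primitive \<tau>" and "aperiodic \<tau>"
    and "substitution \<rho>" and "primitive \<rho>" and "aperiodic \<rho>"
    and "balanced_growth (subst_shift \<tau>) (subst_act \<tau>)"
    and "balanced_growth (subst_shift \<rho>) (subst_act \<rho>)"
    and "growth_rate (subst_shift \<tau>) (subst_act \<tau>) = l"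
    and "growth_rate (subst_shift \<rho>) (subst_act \<rho>) = l"
    and "l > 1"
    and "almost_inverse (subst_shift \<rho>) (subst_shift \<rho>) (subst_act \<rho>) \<rho>inv"
    and "balanced_growth (subst_shift \<rho>) \<rho>inv"
  shows "\<exists>(D :: nat) (I :: nat). \<forall>f. block_map (subst_shift \<tau>) (subst_shift \<rho>) f \<longrightarrow>
    (let X = subst_shift \<tau>; \<Phi> = (\<lambda>i. (\<rho>inv ^^ i) \<circ> f \<circ> (subst_act \<tau> ^^ i)) in
      (\<forall>i. dill_map X (subst_shift \<rho>) (\<Phi> i) \<and> balanced_growth X (\<Phi> i) \<and>
           growth_rate X (\<Phi> i) = 1 \<and> discrepancy X (\<Phi> i) \<le> D) \<and>
      (\<forall>\<^sub>F i in sequentially. impl_radius X (\<Phi> i) \<le> I))"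
proof -
  let ?X = "subst_shift \<tau>" and ?Y = "subst_shift \<rho>"
  have apX: "aperiodic_shift ?X" and apY: "aperiodic_shift ?Y"
    using assms(3,6) by (simp_all add: aperiodic_def aperiodic_shift_def)
  have X: "?X \<noteq> {}" and Y: "?Y \<noteq> {}"
    using assms(7,8) by (simp_all add: balanced_growth_nonempty)
  have l0: "l > 0" using assms(11) by simp

  \<comment> \<open>Cocycle and bounds of \<open>\<tau>\<close>\<close>
  define s where "s = (\<lambda>x. length (\<tau> [x (0::nat)]))"
  have \<tau>c: "dill_cocycle ?X ?X (subst_act \<tau>) s"
    using subst_act_dill_cocycle[OF assms(1,2), of 1] by (simp add: s_def)
  have \<tau>r: "step_radius ?X (subst_act \<tau>) s 0"
    unfolding s_def by (rule subst_act_step_radius[OF assms(1)])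
  obtain T :: nat where \<tau>b: "step_balanced ?X s l (real T)"
    using balanced_growth_step_balanced[OF \<tau>c apX assms(7)] assms(9) by auto

  \<comment> \<open>Cocycle and bounds of \<open>\<rho>\<close>\<close>
  define r where "r = (\<lambda>x. length (\<rho> [x (0::nat)]))"
  have \<rho>c: "dill_cocycle ?Y ?Y (subst_act \<rho>) r"
    using subst_act_dill_cocycle[OF assms(4,5), of 1] by (simp add: r_def)
  obtain P :: nat where \<rho>b: "step_balanced ?Y r l (real P)"
    using balanced_growth_step_balanced[OF \<rho>c apY assms(8)] assms(10) by auto

  \<comment> \<open>Growth rate and radius of the almost inverse\<close>
  obtain t where tc: "dill_cocycle ?Y ?Y \<rho>inv t"
    using assms(12) by (auto simp: almost_inverse_def dill_map_iff)
  obtain E :: nat where tb: "step_balanced ?Y t (growth_rate ?Y \<rho>inv) (real E)"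
    using balanced_growth_step_balanced[OF tc apY assms(13)] by blast
  \<comment> \<open>The product is the growth rate of
    \<open>\<rho>inv \<circ> subst_act \<rho>\<close>, which is almost equal to the
    identity.\<close>
  have "growth_rate ?Y \<rho>inv * l = 1"
  proof (rule almost_identity_rate)
    show "dill_cocycle ?Y ?Y (\<rho>inv \<circ> subst_act \<rho>) (\<lambda>x. step_sum t (r x) (subst_act \<rho> x))"
      by (rule dill_cocycle_compose[OF \<rho>c tc])
    show "step_balanced ?Y (\<lambda>x. step_sum t (r x) (subst_act \<rho> x)) (growth_rate ?Y \<rho>inv * l)
        (real E + \<bar>growth_rate ?Y \<rho>inv\<bar> * real P)"
      by (rule step_balanced_compose[OF \<rho>c \<rho>b tb])
    show "almost_equal ?Y (\<rho>inv \<circ> subst_act \<rho>) id"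
      using assms(12) by (simp add: almost_inverse_def)
  qed (use apY Y recurrent_subst_shift[OF assms(4,5)] in auto)
  then have "growth_rate ?Y \<rho>inv = 1 / l"
    using l0 by (simp add: eq_divide_eq)
  with tb have tb: "step_balanced ?Y t (1 / l) (real E)"
    by (simp only:)
  obtain R where tr: "step_radius ?Y \<rho>inv t R"
    using step_radius_exists[OF tc] by blast
  define K where "K = real R + 1 + l * real E"
  have K: "K \<ge> 0" using l0 by (simp add: K_def)
  define G where "G = (\<lambda>i. \<Sum>j<i. l ^ j)"
  have G: "G i / l ^ i \<le> 1 / (l - 1)" for i
    unfolding G_def by (rule geometric_sum_le[OF assms(11)])

  \<comment> \<open>The first term bounds the discrepancy of \<open>\<rho>inv ^^ i\<close>, the
    second that of \<open>subst_act \<tau> ^^ i\<close> divided by \<open>l ^ i\<close>. Both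
    \<open>D\<close> and \<open>I\<close> are fixed before \<open>f\<close>.\<close>
  define D where "D = nat \<lceil>real E * (l / (l - 1)) + real T * (1 / (l - 1))\<rceil>"
  \<comment> \<open>The first ceiling bounds the radius of
    \<open>f \<circ> (subst_act \<tau> ^^ i)\<close>, with 1 for the share of \<open>f\<close> once
    its radius is at most \<open>l ^ i\<close>; the second bounds the further letters required by
    \<open>\<rho>inv ^^ i\<close>.\<close>
  define I where "I = nat \<lceil>1 + real T * (1 / (l - 1))\<rceil> + nat \<lceil>(K + real T) * (1 / (l - 1))\<rceil>"

  show ?thesis
    unfolding Let_def
  proof (rule exI[of _ D], rule exI[of _ I], intro allI impI)

    \<comment> \<open>The maps \<open>\<Phi> i\<close> for a given block map\<close>
    fix f assume f: "block_map ?X ?Y f"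
    define \<Phi> where "\<Phi> = (\<lambda>i. (\<rho>inv ^^ i) \<circ> f \<circ> (subst_act \<tau> ^^ i))"
    note fc = block_map_dill_cocycle[OF f]
    obtain C where fr: "step_radius ?X f (\<lambda>_. 1) C"
      using step_radius_exists[OF fc] by blast
    \<comment> \<open>\<open>u i\<close> and \<open>v i\<close> have exactly the shape that the
      composition lemmas deliver: first \<open>f\<close> after the iterates of
      \<open>\<tau>\<close>, then the iterates of \<open>\<rho>inv\<close> after both.\<close>
    define u where "u = (\<lambda>i x. step_sum (\<lambda>_. 1) (funpow_step (subst_act \<tau>) s i x) ((subst_act \<tau> ^^ i) x))"
    define v where "v = (\<lambda>i x. step_sum (funpow_step \<rho>inv t i) (u i x) ((f \<circ> (subst_act \<tau> ^^ i)) x))"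
    note \<tau>ci = funpow_dill_cocycle[OF \<tau>c] and tci = funpow_dill_cocycle[OF tc]
    have uc: "dill_cocycle ?X ?Y (f \<circ> (subst_act \<tau> ^^ i)) (u i)" for i
      unfolding u_def by (rule dill_cocycle_compose[OF \<tau>ci fc])
    have vc: "dill_cocycle ?X ?Y (\<Phi> i) (v i)" for i
      unfolding \<Phi>_def v_def o_assoc[symmetric] by (rule dill_cocycle_compose[OF uc tci])
    have \<tau>bi: "step_balanced ?X (funpow_step (subst_act \<tau>) s i) (l ^ i) (real T * G i)" for i
      unfolding G_def using l0 by (intro funpow_step_balanced[OF \<tau>c \<tau>b]) simp
    have ub: "step_balanced ?X (u i) (l ^ i) (real T * G i)" for i
      using step_balanced_compose[OF \<tau>ci \<tau>bi step_balanced_one] by (simp add: u_def)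
    have vb: "step_balanced ?X (v i) 1 (real D)" for i
    proof (rule step_balanced_mono)
      \<comment> \<open>The rates \<open>l ^ i\<close> and \<open>(1 / l) ^ i\<close> cancel to 1,
        and the latter also scales down the discrepancy of \<open>u i\<close>.\<close>
      have "step_balanced ?X (v i) ((1 / l) ^ i * l ^ i)
          (real E * (\<Sum>j<i. (1 / l) ^ j) + \<bar>(1 / l) ^ i\<bar> * (real T * G i))"
        unfolding v_def using l0
        by (intro step_balanced_compose[OF uc ub] funpow_step_balanced[OF tc tb]) simp
      then show "step_balanced ?X (v i) 1 (real E * (\<Sum>j<i. (1 / l) ^ j) + \<bar>(1 / l) ^ i\<bar> * (real T * G i))"
        using l0 by (simp add: power_mult_distrib[symmetric])
      have "\<bar>(1 / l) ^ i\<bar> * (real T * G i) = real T * (G i / l ^ i)"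
        using l0 by (simp add: power_one_over field_simps)
      also have "\<dots> \<le> real T * (1 / (l - 1))"
        by (rule mult_left_mono[OF G]) simp
      finally have "real E * (\<Sum>j<i. (1 / l) ^ j) + \<bar>(1 / l) ^ i\<bar> * (real T * G i)
          \<le> real E * (l / (l - 1)) + real T * (1 / (l - 1))"
        using mult_left_mono[OF geometric_sum_inverse_le[OF assms(11), of i], of "real E"] by simp
      also have "\<dots> \<le> real D"
        unfolding D_def by (rule real_nat_ceiling_ge)
      finally show "real E * (\<Sum>j<i. (1 / l) ^ j) + \<bar>(1 / l) ^ i\<bar> * (real T * G i) \<le> real D" .
    qed
    \<comment> \<open>Only the radius \<open>C\<close> of \<open>f\<close> asks for large
      \<open>i\<close>: it enters divided by \<open>l ^ i\<close>, so the threshold depends on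
      \<open>f\<close> while \<open>I\<close> does not.\<close>
    have radius: "impl_radius ?X (\<Phi> i) \<le> I" if C: "real C \<le> l ^ i" for i
    proof -
      have li: "l ^ i > 0" using l0 by simp
      let ?A = "0 + nat \<lceil>(real C + real T * G i) / l ^ i\<rceil>"
      have ur: "step_radius ?X (f \<circ> (subst_act \<tau> ^^ i)) (u i) ?A"
        unfolding u_def
        by (rule step_radius_compose_balanced[OF \<tau>ci fc funpow_step_radius_0[OF \<tau>c \<tau>r] fr \<tau>bi li])
      obtain B where B: "step_radius ?Y (\<rho>inv ^^ i) (funpow_step \<rho>inv t i) B" "real B \<le> K * G i"
        using funpow_step_radius[OF tc tr tb l0, of i] unfolding K_def G_def by auto
      let ?B = "nat \<lceil>(real B + real T * G i) / l ^ i\<rceil>"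
      have "step_radius ?X (\<Phi> i) (v i) (?A + ?B)"
        unfolding \<Phi>_def v_def o_assoc[symmetric]
        by (rule step_radius_compose_balanced[OF uc tci ur B(1) ub li])
      then have "impl_radius ?X (\<Phi> i) \<le> ?A + ?B"
        by (rule impl_radius_le[OF vc apY])
      moreover have "(real C + real T * G i) / l ^ i \<le> 1 + real T * (1 / (l - 1))"
      proof -
        have "(real C + real T * G i) / l ^ i = real C / l ^ i + real T * (G i / l ^ i)"
          by (simp add: add_divide_distrib)
        also have "\<dots> \<le> 1 + real T * (1 / (l - 1))"
          using C li by (intro add_mono mult_left_mono[OF G]) simp_all
        finally show ?thesis .
      qed
      moreover have "(real B + real T * G i) / l ^ i \<le> (K + real T) * (1 / (l - 1))"
      proof -
        have "(real B + real T * G i) / l ^ i \<le> ((K + real T) * G i) / l ^ i"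
          using B(2) li by (intro divide_right_mono) (simp_all add: distrib_right)
        also have "\<dots> = (K + real T) * (G i / l ^ i)"
          by simp
        also have "\<dots> \<le> (K + real T) * (1 / (l - 1))"
          using K by (intro mult_left_mono[OF G]) simp
        finally show ?thesis .
      qed
      ultimately have "impl_radius ?X (\<Phi> i) \<le> ?A + ?B" "?A + ?B \<le> I"
        unfolding I_def by (auto intro!: add_mono nat_mono ceiling_mono)
      then show ?thesis by (rule order_trans)
    qed
    obtain n where n: "real C < l ^ n"
      using real_arch_pow[OF assms(11)] by blast
    have "\<forall>\<^sub>F i in sequentially. impl_radius ?X (\<Phi> i) \<le> I"
      using eventually_ge_at_top[of n]
    proof eventually_elim
      case (elim i)
      have "l ^ n \<le> l ^ i"
        using elim assms(11) by (simp add: power_increasing)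
      with n show ?case by (intro radius) simp
    qed
    moreover have "dill_map ?X ?Y (\<Phi> i) \<and> balanced_growth ?X (\<Phi> i) \<and>
        growth_rate ?X (\<Phi> i) = 1 \<and> discrepancy ?X (\<Phi> i) \<le> D" for i
      using step_balanced_growth[OF vc apY X vb] vc dill_map_iff by blast
    ultimately show "(\<forall>i. dill_map ?X ?Y ((\<rho>inv ^^ i) \<circ> f \<circ> (subst_act \<tau> ^^ i)) \<and>
          balanced_growth ?X ((\<rho>inv ^^ i) \<circ> f \<circ> (subst_act \<tau> ^^ i)) \<and>
          growth_rate ?X ((\<rho>inv ^^ i) \<circ> f \<circ> (subst_act \<tau> ^^ i)) = 1 \<and>
          discrepancy ?X ((\<rho>inv ^^ i) \<circ> f \<circ> (subst_act \<tau> ^^ i)) \<le> D) \<and>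
        (\<forall>\<^sub>F i in sequentially. impl_radius ?X ((\<rho>inv ^^ i) \<circ> f \<circ> (subst_act \<tau> ^^ i)) \<le> I)"
      unfolding \<Phi>_def by blast
  qed
qed

end
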